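(* Let $\sigma$ be a term ordering, let $F$ be a formula in 2-XNF, and let $G$ be an implication graph structure for $F$. Then the procedure $\mathrm{crGGCP}$ (described in the context) is an algorithm, i.e. it terminates after finitely many steps, which returns a tuple $G'=\mathrm{crGGCP}_\sigma(G)$ with the following properties: (a) The tuple $G'=(L',V',E')$ is a $\sigma$-reduced implication graph structure for $F$. (b) We have $G'\preceq G$. (c) The directed graph $(V',E')$ is acyclic.
   Context: $\mathbb{B}_n=\mathbb{F}_2[X_1,\dots,X_n]/\langle X_1^2-X_1,\dots,X_n^2-X_n\rangle$ is the ring of Boolean polynomials, $x_i$ the residue class of $X_i$, and $\mathbb{L}_n=\langle 1,x_1,\dots,x_n\rangle_{\mathbb{F}_2}$ the space of linear Boolean polynomials. $\mathrm{Supp}(f)$ is the set of square-free terms occurring in $f$. A term ordering $\sigma$ on $\mathbb{F}_2[X_1,\dots,X_n]$ induces an ordering on the square-free terms of $\mathbb{B}_n$, and $\mathrm{LT}_\sigma(f)$ is the largest term in $\mathrm{Supp}(f)$; $\mathrm{LT}_\sigma(L)$ is the set of leading terms of the elements of $L$. $\mathrm{NR}_\sigma(f,L)$ is the normal remainder of $f$ under the division algorithm by the elements of $L$ with respect to $\sigma$ (performed on the canonical square-free representatives). A lineral is an XOR of literals; a formula is in 2-XNF if it is a conjunction of clauses each of which is a disjunction of at most two linerals. For such a formula $F$ in the variables $X_1,\dots,X_n$ (true $=1$, false $=0$), $I_F\subseteq\mathbb{B}_n$ is the unique ideal whose zero set in $\mathbb{F}_2^n$ equals the set of satisfying assignments of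 $F$. An implication graph structure (IGS) for $F$ is a tuple $(L,V,E)$ with $L,V\subseteq\mathbb{L}_n$ and $E\subseteq V^2$ such that (1) $I_F=\langle L\rangle+\langle fg\mid (f+1,g)\in E\rangle$; (2) for all $(f+1,g)\in E$ we have $(g+1,f)\in E$; (3) for all $f\in V$, $(f,f)\notin E$. It is $\sigma$-reduced if the polynomials in $L$ have pairwise distinct leading terms and $\mathrm{LT}_\sigma(L)\cap\bigcup_{f\in V}\mathrm{Supp}(f)=\emptyset$. For two IGSs $G'=(L',V',E')$ and $G=(L,V,E)$ for $F$, $G'\preceq G$ means $\langle L'\rangle_{\mathbb{F}_2}\supseteq\langle L\rangle_{\mathbb{F}_2}$ and $\#V'\le\#V$. A strongly connected component of a directed graph $(V,E)$ is a subset $S\subseteq V$ such that for all $f,g\in S$ there is a path from $f$ to $g$, and which is maximal with this property. Procedure $\mathrm{GGCP}$, with input an IGS $G$ for $F$ and a term ordering $\sigma$: Line 1: Write $G=(L,V,E)$ and $\mathrm{LT}_\sigma$-interreduce $L$ (i.e. pass to a generating set of the same $\mathbb{F}_2$-span whose elements have pairwise distinct leading terms). Line 2: Let $(L',V',E')=(L,\emptyset,\emptyset)$. Lines 3-8: For each $(f,g)\in E$: let $f'=\mathrm{NR}_\sigma(f,L)$ and $g'=\mathrm{NR}_\sigma(g,L)$; if $f'=0$ and $g'\ne0$, append $g'$ to $L'$; if $g'=1$ and $f'\neq1$, append $f'+1$ to $L'$; if $f'\notin\mathbb{F}_2$ and $g'\notin\mathbb{F}_2$ and $f'\ne g'$,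 append $(f',g')$ to $E'$ and append $f'$ and $g'$ to $V'$. Line 9: If $L\ne L'$, set $(L,V,E)=(L',V',E')$ and go to Line 2. Line 10: Otherwise return $(L',V',E')$. Procedure $\mathrm{crGGCP}$, with input an IGS $G$ for $F$ and a term ordering $\sigma$: Line 1: Compute $(L',V',E')=\mathrm{GGCP}_\sigma(G)$ and let $L_{SCC}=\emptyset$. Line 2: Compute the set $\mathcal{C}$ of all strongly connected components of $(V',E')$. Line 3: If $\#\mathcal{C}$ is odd, return $(\mathbb{L}_n,\emptyset,\emptyset)$. Lines 4-5: For each $S\in\mathcal{C}$ write $S=\{f_1,\dots,f_r\}$ and, for all $i\in\{2,\dots,r\}$, append $f_1+f_i$ to $L_{SCC}$. Line 6: If $L_{SCC}\neq\emptyset$, set $G=(L'\cup L_{SCC},V',E')$ and go to Line 1. Line 7: Otherwise return $(L',V',E')$.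
   Formalization: In GGCP, Line 9 returns to Line 1 (L is interreduced again) instead of Line 2; in crGGCP, Line 3 returns an interreduced generating set of L_n instead of the set L_n; strongly connected components are taken to be nonempty. As printed, (a) fails. *)

theory Defs
  imports "HOL-Library.Poly_Mapping" "HOL-Library.Z2" HOL.Vector_Spaces
begin

section \<open>Polynomials and Boolean polynomials\<close>

text \<open>
  The indeterminates are indexed by a finite type \<open>'n\<close>, so $n$ is \<open>CARD('n)\<close>. Terms
  $X_1^{a_1} \cdots X_n^{a_n}$ are exponent vectors, written additively: the product of
  terms is \<open>+\<close> and the term $1$ is \<open>0\<close>.
\<close>

type_synonym 'n trm = "'n \<Rightarrow>\<^sub>0 nat"
type_synonym 'n mpoly = "('n \<Rightarrow>\<^sub>0 nat) \<Rightarrow>\<^sub>0 bit"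

abbreviation var_term :: "'n \<Rightarrow> 'n trm" where
  "var_term i \<equiv> Poly_Mapping.single i 1"

abbreviation monomial :: "'n trm \<Rightarrow> 'n mpoly" where
  "monomial t \<equiv> Poly_Mapping.single t 1"

abbreviation Var :: "'n \<Rightarrow> 'n mpoly" where
  "Var i \<equiv> monomial (var_term i)"

global_interpretation ideal: module "(*) :: 'a::comm_ring_1 \<Rightarrow> 'a \<Rightarrow> 'a"
  by standard (simp_all add: algebra_simps)

text \<open>Hence \<open>ideal.span S\<close> is the ideal generated by \<open>S\<close>, and \<open>ideal.subspace I\<close> says that
  \<open>I\<close> is an ideal.\<close>

definition term_eval :: "('n::finite \<Rightarrow> bit) \<Rightarrow> 'n trm \<Rightarrow> bit" where
  "term_eval a t = (\<Prod>i\<in>UNIV. a i ^ Poly_Mapping.lookup t i)"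

definition mpoly_eval :: "('n::finite \<Rightarrow> bit) \<Rightarrow> 'n mpoly \<Rightarrow> bit" where
  "mpoly_eval a p =
     (\<Sum>t\<in>Poly_Mapping.keys p. Poly_Mapping.lookup p t * term_eval a t)"

lemma mpoly_eval_superset:
  assumes "finite T" "Poly_Mapping.keys p \<subseteq> T"
  shows "mpoly_eval a p = (\<Sum>t\<in>T. Poly_Mapping.lookup p t * term_eval a t)"
  unfolding mpoly_eval_def
  by (rule sum.mono_neutral_left) (use assms in \<open>auto simp: in_keys_iff\<close>)

lemma mpoly_eval_0 [simp]: "mpoly_eval a 0 = 0"
  by (simp add: mpoly_eval_def)

lemma mpoly_eval_add: "mpoly_eval a (p + q) = mpoly_eval a p + mpoly_eval a q"
proof -
  let ?T = "Poly_Mapping.keys p \<union> Poly_Mapping.keys q"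
  have "Poly_Mapping.keys (p + q) \<subseteq> ?T" by (rule keys_add)
  then show ?thesis
    by (simp add: mpoly_eval_superset[of ?T] lookup_add distrib_right sum.distrib
          del: add_bit_eq_xor mult_bit_eq_and)
qed

lemma mpoly_eval_sum: "mpoly_eval a (sum f A) = (\<Sum>x\<in>A. mpoly_eval a (f x))"
  by (induction A rule: infinite_finite_induct)
     (simp_all add: mpoly_eval_add del: add_bit_eq_xor)

lemma mpoly_eval_single: "mpoly_eval a (Poly_Mapping.single t c) = c * term_eval a t"
  by (simp add: mpoly_eval_superset[of "{t}"])

lemma term_eval_add: "term_eval a (s + t) = term_eval a s * term_eval a t"
  by (simp add: term_eval_def lookup_add power_add prod.distrib
        del: mult_bit_eq_and power_bit_unfold)

lemma mpoly_as_sum: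
  "p = (\<Sum>t\<in>Poly_Mapping.keys p. Poly_Mapping.single t (Poly_Mapping.lookup p t))"
proof (rule poly_mapping_eqI)
  fix k
  have "(\<Sum>t\<in>Poly_Mapping.keys p. (Poly_Mapping.lookup p t when t = k))
      = (\<Sum>t\<in>Poly_Mapping.keys p. if t = k then Poly_Mapping.lookup p t else 0)"
    by (simp add: when_def)
  also have "\<dots> = Poly_Mapping.lookup p k" by (simp add: in_keys_iff)
  finally show "Poly_Mapping.lookup p k = Poly_Mapping.lookup
      (\<Sum>t\<in>Poly_Mapping.keys p. Poly_Mapping.single t (Poly_Mapping.lookup p t)) k"
    by (simp add: lookup_sum lookup_single)
qed

lemma mpoly_eval_mult: "mpoly_eval a (p * q) = mpoly_eval a p * mpoly_eval a q"
proof -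
  let ?s = "\<lambda>p t. Poly_Mapping.single t (Poly_Mapping.lookup p t)"
  have "mpoly_eval a (p * q) =
      mpoly_eval a (sum (?s p) (Poly_Mapping.keys p) * sum (?s q) (Poly_Mapping.keys q))"
    using mpoly_as_sum[of p] mpoly_as_sum[of q] by (rule arg_cong2)
  also have "\<dots> = (\<Sum>s\<in>Poly_Mapping.keys p. \<Sum>t\<in>Poly_Mapping.keys q.
      Poly_Mapping.lookup p s * Poly_Mapping.lookup q t * term_eval a (s + t))"
    by (simp only: sum_product mult_single mpoly_eval_sum mpoly_eval_single)
  also have "\<dots> = mpoly_eval a p * mpoly_eval a q"
    unfolding mpoly_eval_def sum_product term_eval_add by (simp only: ac_simps)
  finally show ?thesis .
qed

definition field_ideal :: "'n mpoly set" where
  "field_ideal = ideal.span {Var i ^ 2 - Var i | i. True}"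

lemma mpoly_eval_diff: "mpoly_eval a (p - q) = mpoly_eval a p - mpoly_eval a q"
  by (metis add_diff_cancel diff_add_cancel mpoly_eval_add)

lemma mpoly_eval_field_ideal:
  assumes "p \<in> field_ideal"
  shows "mpoly_eval a p = 0"
  using assms unfolding field_ideal_def
proof (induction rule: ideal.span_induct_alt)
  case base
  show ?case by simp
next
  case (step c x y)
  have "b * b - b = 0" for b :: bit by (cases b) auto
  then have "mpoly_eval a x = 0"
    using step(1) by (auto simp: power2_eq_square mpoly_eval_diff mpoly_eval_mult
        simp del: add_bit_eq_xor mult_bit_eq_and)
  then show ?case
    using step by (simp add: mpoly_eval_add mpoly_eval_mult del: add_bit_eq_xor)
qed

definition field_equiv :: "'n mpoly \<Rightarrow> 'n mpoly \<Rightarrow> bool" where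
  "field_equiv p q \<longleftrightarrow> p - q \<in> field_ideal"

lemma field_ideal_mult: "p \<in> field_ideal \<Longrightarrow> q * p \<in> field_ideal"
  unfolding field_ideal_def by (rule ideal.span_scale)

lemma field_ideal_add: "p \<in> field_ideal \<Longrightarrow> q \<in> field_ideal \<Longrightarrow> p + q \<in> field_ideal"
  unfolding field_ideal_def by (rule ideal.span_add)

lemma field_ideal_uminus: "p \<in> field_ideal \<Longrightarrow> - p \<in> field_ideal"
  unfolding field_ideal_def by (rule ideal.span_neg)

lemma equivp_field_equiv: "equivp (field_equiv :: 'a mpoly \<Rightarrow> _)"
proof (rule equivpI)
  show "reflp (field_equiv :: 'a mpoly \<Rightarrow> _)"
    by (simp add: reflp_def field_equiv_def field_ideal_def ideal.span_zero)
  show "symp (field_equiv :: 'a mpoly \<Rightarrow> _)"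
    unfolding symp_def field_equiv_def by (metis field_ideal_uminus minus_diff_eq)
  show "transp (field_equiv :: 'a mpoly \<Rightarrow> _)"
  proof (rule transpI)
    fix p q r :: "'a mpoly"
    assume "field_equiv p q" "field_equiv q r"
    then have "(p - q) + (q - r) \<in> field_ideal"
      unfolding field_equiv_def by (rule field_ideal_add)
    then show "field_equiv p r" by (simp add: field_equiv_def)
  qed
qed

lemma field_equiv_refl: "p = q \<Longrightarrow> field_equiv p q"
  using equivp_reflp[OF equivp_field_equiv] by simp

quotient_type 'n bpoly = "'n mpoly" / field_equiv
  morphisms rep_bpoly bclass
  by (rule equivp_field_equiv)

instantiation bpoly :: (finite) comm_ring_1
begin

lift_definition zero_bpoly :: "'a bpoly" is 0 .
lift_definition one_bpoly :: "'a bpoly" is 1 .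

lift_definition plus_bpoly :: "'a bpoly \<Rightarrow> 'a bpoly \<Rightarrow> 'a bpoly" is "(+)"
proof -
  fix p p' q q' :: "'a mpoly"
  assume "field_equiv p p'" "field_equiv q q'"
  then have "(p - p') + (q - q') \<in> field_ideal"
    unfolding field_equiv_def by (rule field_ideal_add)
  then show "field_equiv (p + q) (p' + q')"
    by (simp add: field_equiv_def algebra_simps)
qed

lift_definition uminus_bpoly :: "'a bpoly \<Rightarrow> 'a bpoly" is uminus
proof -
  fix p p' :: "'a mpoly"
  assume "field_equiv p p'"
  then have "- (p - p') \<in> field_ideal"
    unfolding field_equiv_def by (rule field_ideal_uminus)
  then show "field_equiv (- p) (- p')"
    by (simp add: field_equiv_def)
qed

lift_definition minus_bpoly :: "'a bpoly \<Rightarrow> 'a bpoly \<Rightarrow> 'a bpoly" is "(-)"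
proof -
  fix p p' q q' :: "'a mpoly"
  assume "field_equiv p p'" "field_equiv q q'"
  then have "(p - p') + - (q - q') \<in> field_ideal"
    unfolding field_equiv_def by (intro field_ideal_add field_ideal_uminus)
  then show "field_equiv (p - q) (p' - q')"
    by (simp add: field_equiv_def algebra_simps)
qed

lift_definition times_bpoly :: "'a bpoly \<Rightarrow> 'a bpoly \<Rightarrow> 'a bpoly" is "(*)"
proof -
  fix p p' q q' :: "'a mpoly"
  assume "field_equiv p p'" "field_equiv q q'"
  then have "q * (p - p') + p' * (q - q') \<in> field_ideal"
    unfolding field_equiv_def by (intro field_ideal_add field_ideal_mult)
  then show "field_equiv (p * q) (p' * q')"
    by (simp add: field_equiv_def algebra_simps)
qed

instance
proof
  fix a b c :: "'a bpoly"
  show "a + b + c = a + (b + c)" by transfer (rule field_equiv_refl, rule add.assoc)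
  show "a + b = b + a" by transfer (rule field_equiv_refl, rule add.commute)
  show "0 + a = a" by transfer (rule field_equiv_refl, rule add_0)
  show "- a + a = 0" by transfer (rule field_equiv_refl, rule left_minus)
  show "a - b = a + - b" by transfer (rule field_equiv_refl, rule diff_conv_add_uminus)
  show "a * b * c = a * (b * c)" by transfer (rule field_equiv_refl, rule mult.assoc)
  show "a * b = b * a" by transfer (rule field_equiv_refl, rule mult.commute)
  show "1 * a = a" by transfer (rule field_equiv_refl, rule mult_1)
  show "(a + b) * c = a * c + b * c" by transfer (rule field_equiv_refl, rule distrib_right)
  show "(0 :: 'a bpoly) \<noteq> 1"
  proof (transfer, rule notI)
    assume "field_equiv (0 :: 'a mpoly) 1"
    then have "mpoly_eval (\<lambda>_. 0) (0 - 1 :: 'a mpoly) = 0"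
      unfolding field_equiv_def by (rule mpoly_eval_field_ideal)
    moreover have "mpoly_eval (\<lambda>_. 0) (1 :: 'a mpoly) = 1"
      using mpoly_eval_single[of "\<lambda>_. 0" 0 1] by (simp add: term_eval_def)
    ultimately show False unfolding mpoly_eval_diff by simp
  qed
qed

end

lift_definition bscale :: "bit \<Rightarrow> 'n::finite bpoly \<Rightarrow> 'n bpoly"
  is "\<lambda>c p. Poly_Mapping.single 0 c * p"
  unfolding field_equiv_def by (metis field_ideal_mult right_diff_distrib)

text \<open>\<open>F2.span\<close> is the span over the field with two elements.\<close>

global_interpretation F2: vector_space "bscale :: bit \<Rightarrow> 'n::finite bpoly \<Rightarrow> 'n bpoly"
proof
  fix a b :: bit and x y :: "'n bpoly"
  show "bscale a (x + y) = bscale a x + bscale a y"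
    by transfer (rule field_equiv_refl, simp add: algebra_simps)
  show "bscale (a + b) x = bscale a x + bscale b x"
    by transfer (rule field_equiv_refl, simp add: single_add algebra_simps del: add_bit_eq_xor)
  show "bscale a (bscale b x) = bscale (a * b) x"
    by transfer (rule field_equiv_refl,
      simp add: mult_single mult.assoc[symmetric] del: mult_bit_eq_and)
  show "bscale 1 x = x" by transfer (rule field_equiv_refl, simp)
qed

lift_definition beval :: "('n::finite \<Rightarrow> bit) \<Rightarrow> 'n bpoly \<Rightarrow> bit" is mpoly_eval
  unfolding field_equiv_def
  by (metis mpoly_eval_field_ideal mpoly_eval_diff eq_iff_diff_eq_0)

definition bvar :: "'n::finite \<Rightarrow> 'n bpoly" where
  "bvar i = bclass (Var i)"

definition linear_bpolys :: "'n::finite bpoly set" where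
  "linear_bpolys = F2.span (insert 1 (range bvar))"

definition squarefree_mpoly :: "'n mpoly \<Rightarrow> bool" where
  "squarefree_mpoly p \<longleftrightarrow> (\<forall>t\<in>Poly_Mapping.keys p. \<forall>i. Poly_Mapping.lookup t i \<le> 1)"

text \<open>Every residue class contains exactly one square-free polynomial.\<close>

definition canonical :: "'n::finite bpoly \<Rightarrow> 'n mpoly" where
  "canonical f = (THE p. squarefree_mpoly p \<and> bclass p = f)"

definition Supp :: "'n::finite bpoly \<Rightarrow> 'n trm set" where
  "Supp f = Poly_Mapping.keys (canonical f)"


section \<open>Term orderings, leading terms and normal remainders\<close>

text \<open>\<open>(s, t) \<in> \<sigma>\<close> means that \<open>s\<close> is at most \<open>t\<close>.\<close>

definition term_ordering :: "'n trm rel \<Rightarrow> bool" where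
  "term_ordering \<sigma> \<longleftrightarrow> linear_order \<sigma> \<and> (\<forall>t. (0, t) \<in> \<sigma>) \<and>
     (\<forall>s t u. (s, t) \<in> \<sigma> \<longrightarrow> (s + u, t + u) \<in> \<sigma>)"

definition mpoly_LT :: "'n trm rel \<Rightarrow> 'n mpoly \<Rightarrow> 'n trm" where
  "mpoly_LT \<sigma> p =
     (THE t. t \<in> Poly_Mapping.keys p \<and> (\<forall>s\<in>Poly_Mapping.keys p. (s, t) \<in> \<sigma>))"

definition LT :: "'n trm rel \<Rightarrow> 'n::finite bpoly \<Rightarrow> 'n trm" where
  "LT \<sigma> f = mpoly_LT \<sigma> (canonical f)"

text \<open>
  One step of the division algorithm by the polynomials in \<open>D\<close>, on pairs (intermediate
  dividend, partial remainder). Over the field with two elements all leading coefficients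
  are $1$.
\<close>

inductive division_step ::
  "'n trm rel \<Rightarrow> 'n mpoly set \<Rightarrow> 'n mpoly \<times> 'n mpoly \<Rightarrow> 'n mpoly \<times> 'n mpoly \<Rightarrow> bool"
  for \<sigma> :: "'n trm rel" and D :: "'n mpoly set" where
  reduce: "\<lbrakk>v \<noteq> 0; g \<in> D; g \<noteq> 0; mpoly_LT \<sigma> v = u + mpoly_LT \<sigma> g\<rbrakk>
    \<Longrightarrow> division_step \<sigma> D (v, r) (v - monomial u * g, r)"
| move: "\<lbrakk>v \<noteq> 0; \<nexists>g u. g \<in> D \<and> g \<noteq> 0 \<and> mpoly_LT \<sigma> v = u + mpoly_LT \<sigma> g\<rbrakk>
    \<Longrightarrow> division_step \<sigma> D (v, r)
          (v - monomial (mpoly_LT \<sigma> v), r + monomial (mpoly_LT \<sigma> v))"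

text \<open>The remainder does not depend on the choices made in the division if \<open>f\<close> and \<open>L\<close> are
  linear and \<open>L\<close> has pairwise distinct leading terms, which is the only case used below.\<close>

definition NR :: "'n trm rel \<Rightarrow> 'n::finite bpoly \<Rightarrow> 'n bpoly set \<Rightarrow> 'n bpoly" where
  "NR \<sigma> f L = bclass (THE r. (division_step \<sigma> (canonical ` L))\<^sup>*\<^sup>* (canonical f, 0) (0, r))"

text \<open>The zero polynomial has no leading term, hence is excluded.\<close>

definition distinct_LTs :: "'n trm rel \<Rightarrow> 'n::finite bpoly set \<Rightarrow> bool" where
  "distinct_LTs \<sigma> L \<longleftrightarrow> 0 \<notin> L \<and> inj_on (LT \<sigma>) L"

definition LT_interreduction ::
  "'n trm rel \<Rightarrow> 'n::finite bpoly set \<Rightarrow> 'n bpoly set \<Rightarrow> bool" where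
  "LT_interreduction \<sigma> L L' \<longleftrightarrow> F2.span L' = F2.span L \<and> distinct_LTs \<sigma> L'"


section \<open>Formulas in 2-XNF\<close>

datatype 'n literal = Pos 'n | Neg 'n

type_synonym 'n lineral = "'n literal list"
type_synonym 'n clause = "'n lineral list"
type_synonym 'n xnf = "'n clause list"

fun sat_literal :: "('n \<Rightarrow> bit) \<Rightarrow> 'n literal \<Rightarrow> bool" where
  "sat_literal a (Pos i) \<longleftrightarrow> a i = 1"
| "sat_literal a (Neg i) \<longleftrightarrow> a i = 0"

text \<open>On truth values, exclusive or is \<open>\<noteq>\<close>.\<close>

definition sat_lineral :: "('n \<Rightarrow> bit) \<Rightarrow> 'n lineral \<Rightarrow> bool" where
  "sat_lineral a l \<longleftrightarrow> foldr (\<lambda>x b. sat_literal a x \<noteq> b) l False"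

definition sat :: "('n \<Rightarrow> bit) \<Rightarrow> 'n xnf \<Rightarrow> bool" where
  "sat a F \<longleftrightarrow> (\<forall>C\<in>set F. \<exists>l\<in>set C. sat_lineral a l)"

definition two_xnf :: "'n xnf \<Rightarrow> bool" where
  "two_xnf F \<longleftrightarrow> (\<forall>C\<in>set F. length C \<le> 2)"

definition zero_set :: "'n::finite bpoly set \<Rightarrow> ('n \<Rightarrow> bit) set" where
  "zero_set I = {a. \<forall>f\<in>I. beval a f = 0}"

definition formula_ideal :: "'n::finite xnf \<Rightarrow> 'n bpoly set" where
  "formula_ideal F = (THE I. ideal.subspace I \<and> zero_set I = {a. sat a F})"


section \<open>Implication graph structures\<close>

type_synonym 'n igs = "'n bpoly set \<times> 'n bpoly set \<times> 'n bpoly rel"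

fun is_IGS :: "'n::finite xnf \<Rightarrow> 'n igs \<Rightarrow> bool" where
  "is_IGS F (L, V, E) \<longleftrightarrow>
     L \<subseteq> linear_bpolys \<and> V \<subseteq> linear_bpolys \<and> E \<subseteq> V \<times> V \<and>
     formula_ideal F =
       {p + q | p q. p \<in> ideal.span L \<and> q \<in> ideal.span {f * g | f g. (f + 1, g) \<in> E}} \<and>
     (\<forall>f g. (f + 1, g) \<in> E \<longrightarrow> (g + 1, f) \<in> E) \<and>
     (\<forall>f\<in>V. (f, f) \<notin> E)"

fun reduced_IGS :: "'n trm rel \<Rightarrow> 'n::finite igs \<Rightarrow> bool" where
  "reduced_IGS \<sigma> (L, V, E) \<longleftrightarrow>
     distinct_LTs \<sigma> L \<and> LT \<sigma> ` L \<inter> (\<Union>f\<in>V. Supp f) = {}"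

fun igs_le :: "'n::finite igs \<Rightarrow> 'n igs \<Rightarrow> bool" (infix \<open>\<preceq>\<close> 50) where
  "(L', V', E') \<preceq> (L, V, E) \<longleftrightarrow> F2.span L \<subseteq> F2.span L' \<and> card V' \<le> card V"


section \<open>The procedures GGCP and crGGCP\<close>

text \<open>
  The procedures contain free choices (the interreduction of \<open>L\<close>, the enumeration of a
  component), hence are given as transition relations. The loop body only reads \<open>L\<close> and only
  adds elements, so one run through the loop over \<open>E\<close> is described by its result.
\<close>

fun GGCP_pass :: "'n trm rel \<Rightarrow> 'n::finite bpoly set \<Rightarrow> 'n bpoly rel \<Rightarrow> 'n igs" where
  "GGCP_pass \<sigma> L E =
    (let E' = {(NR \<sigma> f L, NR \<sigma> g L) | f g. (f, g) \<in> E \<and>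
                 NR \<sigma> f L \<notin> {0, 1} \<and> NR \<sigma> g L \<notin> {0, 1} \<and> NR \<sigma> f L \<noteq> NR \<sigma> g L}
     in (L \<union> {NR \<sigma> g L | f g. (f, g) \<in> E \<and> NR \<sigma> f L = 0 \<and> NR \<sigma> g L \<noteq> 0}
           \<union> {NR \<sigma> f L + 1 | f g. (f, g) \<in> E \<and> NR \<sigma> g L = 1 \<and> NR \<sigma> f L \<noteq> 1},
         Field E', E'))"

datatype 'n GGCP_state =
    GGCP_Run "'n igs"
  | GGCP_Return "'n igs"

text \<open>
  Each repetition starts with the interreduction of \<open>L\<close>: without it, polynomials with the
  same leading term appended in one pass would stay in \<open>L\<close> for good, so that the output need
  not be reduced.
\<close>

inductive GGCP_step :: "'n trm rel \<Rightarrow> 'n::finite GGCP_state \<Rightarrow> 'n GGCP_state \<Rightarrow> bool"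
  for \<sigma> :: "'n trm rel" where
  repeat: "\<lbrakk>LT_interreduction \<sigma> L L\<^sub>0; GGCP_pass \<sigma> L\<^sub>0 E = (L', V', E'); L\<^sub>0 \<noteq> L'\<rbrakk>
    \<Longrightarrow> GGCP_step \<sigma> (GGCP_Run (L, V, E)) (GGCP_Run (L', V', E'))"
| return: "\<lbrakk>LT_interreduction \<sigma> L L\<^sub>0; GGCP_pass \<sigma> L\<^sub>0 E = (L', V', E'); L\<^sub>0 = L'\<rbrakk>
    \<Longrightarrow> GGCP_step \<sigma> (GGCP_Run (L, V, E)) (GGCP_Return (L', V', E'))"

text \<open>For \<open>E \<subseteq> V \<times> V\<close>, a path from \<open>f\<close> to \<open>g\<close> exists if and only if \<open>(f, g) \<in> E\<^sup>*\<close>.\<close>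

definition strongly_connected_in :: "'v set \<Rightarrow> 'v rel \<Rightarrow> 'v set \<Rightarrow> bool" where
  "strongly_connected_in V E S \<longleftrightarrow> S \<subseteq> V \<and> (\<forall>f\<in>S. \<forall>g\<in>S. (f, g) \<in> E\<^sup>*)"

text \<open>Nonemptiness matters only for the empty graph, which has no components.\<close>

definition SCCs :: "'v set \<Rightarrow> 'v rel \<Rightarrow> 'v set set" where
  "SCCs V E = {S. S \<noteq> {} \<and> strongly_connected_in V E S \<and>
     (\<forall>T. strongly_connected_in V E T \<and> S \<subseteq> T \<longrightarrow> T = S)}"

text \<open>\<open>c S\<close> is the element listed first in the enumeration of the component \<open>S\<close>.\<close>

definition SCC_polys :: "('n::finite bpoly set \<Rightarrow> 'n bpoly) \<Rightarrow> 'n bpoly set set \<Rightarrow> 'n bpoly set"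
  where "SCC_polys c \<C> = (\<Union>S\<in>\<C>. {c S + f | f. f \<in> S - {c S}})"

datatype 'n crGGCP_state =
    In_GGCP "'n GGCP_state"
  | crGGCP_Return "'n igs"

text \<open>
  In rule \<open>odd\<close>, the space of all linear Boolean polynomials is returned in the form of an
  interreduced generating set, since the space itself does not have pairwise distinct leading
  terms.
\<close>

inductive crGGCP_step :: "'n trm rel \<Rightarrow> 'n::finite crGGCP_state \<Rightarrow> 'n crGGCP_state \<Rightarrow> bool"
  for \<sigma> :: "'n trm rel" where
  GGCP: "GGCP_step \<sigma> s t \<Longrightarrow> crGGCP_step \<sigma> (In_GGCP s) (In_GGCP t)"
| odd: "\<lbrakk>odd (card (SCCs V' E')); LT_interreduction \<sigma> linear_bpolys B\<rbrakk>
    \<Longrightarrow> crGGCP_step \<sigma> (In_GGCP (GGCP_Return (L', V', E'))) (crGGCP_Return (B, {}, {}))"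
| repeat: "\<lbrakk>even (card (SCCs V' E')); \<forall>S\<in>SCCs V' E'. c S \<in> S;
      SCC_polys c (SCCs V' E') \<noteq> {}\<rbrakk>
    \<Longrightarrow> crGGCP_step \<sigma> (In_GGCP (GGCP_Return (L', V', E')))
          (In_GGCP (GGCP_Run (L' \<union> SCC_polys c (SCCs V' E'), V', E')))"
| return: "\<lbrakk>even (card (SCCs V' E')); \<forall>S\<in>SCCs V' E'. c S \<in> S;
      SCC_polys c (SCCs V' E') = {}\<rbrakk>
    \<Longrightarrow> crGGCP_step \<sigma> (In_GGCP (GGCP_Return (L', V', E'))) (crGGCP_Return (L', V', E'))"

definition crGGCP_start :: "'n igs \<Rightarrow> 'n crGGCP_state" where
  "crGGCP_start G = In_GGCP (GGCP_Run G)"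

text \<open>Every run is finite, and a run can only end by returning a tuple.\<close>

definition crGGCP_terminates :: "'n trm rel \<Rightarrow> 'n::finite igs \<Rightarrow> bool" where
  "crGGCP_terminates \<sigma> G \<longleftrightarrow>
     (\<nexists>r. r 0 = crGGCP_start G \<and> (\<forall>k::nat. crGGCP_step \<sigma> (r k) (r (Suc k)))) \<and>
     (\<forall>s. (crGGCP_step \<sigma>)\<^sup>*\<^sup>* (crGGCP_start G) s \<and> (\<nexists>t. crGGCP_step \<sigma> s t) \<longrightarrow>
        (\<exists>G'. s = crGGCP_Return G'))"

definition crGGCP_output :: "'n trm rel \<Rightarrow> 'n::finite igs \<Rightarrow> 'n igs \<Rightarrow> bool" where
  "crGGCP_output \<sigma> G G' \<longleftrightarrow> (crGGCP_step \<sigma>)\<^sup>*\<^sup>* (crGGCP_start G) (crGGCP_Return G')"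

end

theory Submission
  imports Defs "HOL-Library.Disjoint_Sets"
begin

text \<open>
  Boolean polynomials are determined by their values, so an ideal of $\mathbb{B}_n$ consists of
  all polynomials vanishing on its zero set. The ideal condition on an implication graph
  structure thus only concerns the common solutions of \<open>L\<close> and \<open>E\<close>, where an edge \<open>(p, q)\<close>
  says that \<open>p = 0\<close> implies \<open>q = 0\<close>. Normal remainders modulo \<open>L\<close> have the same values on
  the zeros of \<open>L\<close>, hence a pass of GGCP preserves the solutions. Every polynomial added to \<open>L\<close>
  is nonzero and its support avoids the leading terms of \<open>L\<close>, so it lies outside the span of
  \<open>L\<close>; the span grows strictly and the procedure terminates. If some \<open>f\<close> and \<open>f + 1\<close> lie in
  the same component, then the formula is unsatisfiable; otherwise adding \<open>1\<close> is a
  fixed-point-free involution on the components, whose number is then even.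
\<close>


text \<open>The deleted rules turn ring operations on \<open>bit\<close> into bitwise logic, which
  hides the sums and products that the ring lemmas below match.\<close>

declare add_bit_eq_xor [simp del] mult_bit_eq_and [simp del] power_bit_unfold [simp del]

lemma bit_add_self [simp]: "(b::bit) + b = 0"
  by (cases b) (simp_all add: one_add_one)

section \<open>Boolean polynomials\<close>

lemma mpoly_add_self [simp]: "(p :: 'n mpoly) + p = 0"
  by (rule poly_mapping_eqI) (simp only: lookup_add lookup_zero bit_add_self)

lemma mpoly_2_eq_0 [simp]: "(2 :: 'n mpoly) = 0"
  by (metis mpoly_add_self one_add_one)

text \<open>In characteristic 2 every element is its own negative, so subtraction can be eliminated
  throughout.\<close>

lemma mpoly_minus_eq_plus [simp]: "(p :: 'n mpoly) - q = p + q"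
  using minus_unique [OF mpoly_add_self, of q] by (simp add: diff_conv_add_uminus del: add_uminus_conv_diff)

lemma bclass_plus: "bclass p + bclass q = bclass (p + q)"
  and bclass_times: "bclass p * bclass q = bclass (p * q)"
  and bclass_0: "bclass 0 = 0"
  and bclass_1: "bclass 1 = 1"
  by (simp_all add: plus_bpoly.abs_eq times_bpoly.abs_eq zero_bpoly_def one_bpoly_def)

lemma bpoly_add_self [simp]: "(f :: 'n::finite bpoly) + f = 0"
  by (metis (full_types) Quotient3_abs_rep Quotient3_bpoly bclass_plus mpoly_add_self bclass_0)

lemma bpoly_2_eq_0 [simp]: "(2 :: 'n::finite bpoly) = 0"
  by (metis bpoly_add_self one_add_one)

lemma bpoly_minus_eq_plus [simp]: "(f :: 'n::finite bpoly) - g = f + g"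
  using minus_unique [OF bpoly_add_self, of g] by (simp add: diff_conv_add_uminus del: add_uminus_conv_diff)

lemma bpoly_add_cancel [simp]: "f + (f + g) = (g :: 'n::finite bpoly)"
  by (simp flip: add.assoc)

lemma bpoly_add_cancel' [simp]: "g + f + f = (g :: 'n::finite bpoly)"
  by (simp add: add.assoc)

lemma bpoly_add_eq_0 [simp]: "f + g = 0 \<longleftrightarrow> f = (g :: 'n::finite bpoly)"
  by (metis add.right_neutral bpoly_add_cancel bpoly_add_self)

lemma bvar_mult_self: "bvar i * bvar i = bvar i"
proof -
  have "Var i ^ 2 - Var i \<in> field_ideal"
    unfolding field_ideal_def by (rule ideal.span_base) auto
  then show ?thesis
    unfolding bvar_def bclass_times bpoly.abs_eq_iff field_equiv_def power2_eq_square .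
qed

lemma bclass_surj: obtains p where "f = bclass p"
  by (metis Quotient3_abs_rep Quotient3_bpoly)

text \<open>Monomials are built from 1 by multiplying with indeterminates, by induction on the total
  degree; sums of monomials then reach every residue class.\<close>

lemma bpoly_induct [case_names zero one var add]:
  fixes f :: "'n::finite bpoly"
  assumes "P 0" "P 1" "\<And>i f. P f \<Longrightarrow> P (bvar i * f)" "\<And>f g. P f \<Longrightarrow> P g \<Longrightarrow> P (f + g)"
  shows "P f"
proof -
  have mono: "P (bclass (monomial t))" for t :: "'n trm"
  proof (induction "\<Sum>i\<in>UNIV. Poly_Mapping.lookup t i" arbitrary: t)
    case 0
    then have "t = 0" by (intro poly_mapping_eqI) simp
    then show ?case using assms(2) by (simp flip: bclass_1)
  next
    case (Suc m)
    from Suc(2) have "(\<Sum>i\<in>UNIV. Poly_Mapping.lookup t i) \<noteq> 0" by linarith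
    then obtain i where i: "Poly_Mapping.lookup t i \<noteq> 0"
      by (rule sum.not_neutral_contains_not_neutral) blast
    \<comment> \<open>Subtraction of exponents is truncated; it is exact here because
      \<open>i\<close> occurs in \<open>t\<close>.\<close>
    define u where "u = t - var_term i"
    have t: "t = var_term i + u"
      using i by (intro poly_mapping_eqI)
        (auto simp: u_def lookup_add lookup_minus lookup_single when_def)
    have "(\<Sum>i\<in>UNIV. Poly_Mapping.lookup t i) = 1 + (\<Sum>i\<in>UNIV. Poly_Mapping.lookup u i)"
      by (simp add: t lookup_add sum.distrib lookup_single when_def)
    then have "P (bclass (monomial u))" using Suc by simp
    moreover have "bclass (monomial t) = bvar i * bclass (monomial u)"
      by (simp add: bvar_def bclass_times mult_single t)
    ultimately show ?case using assms(3) by simp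
  qed
  obtain p where f: "f = bclass p" by (rule bclass_surj)
  \<comment> \<open>\<open>T\<close> and \<open>c\<close> are arbitrary so that terms can be removed
    one at a time; a coefficient in \<open>bit\<close> makes each summand 0 or a monomial.\<close>
  have "P (bclass (\<Sum>t\<in>T. Poly_Mapping.single t (c t)))" if "finite T" for T :: "'n trm set" and c
    using that
  proof induction
    case empty
    then show ?case using assms(1) by (simp add: bclass_0)
  next
    case (insert t T)
    then show ?case
      using assms(4) [OF mono [of t]] by (cases "c t") (simp_all flip: bclass_plus)
  qed
  from this [OF finite_keys] show ?thesis unfolding f by (subst mpoly_as_sum)
qed

section \<open>Canonical square-free representatives\<close>

lemma squarefree_mpoly_add: "squarefree_mpoly p \<Longrightarrow> squarefree_mpoly q \<Longrightarrow> squarefree_mpoly (p + q)"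
  unfolding squarefree_mpoly_def using keys_add [of p q] by blast

lemma bclass_monomial_absorb:
  assumes "Poly_Mapping.lookup t i \<noteq> 0"
  shows "bvar i * bclass (monomial t) = bclass (monomial t)"
proof -
  have t: "t = var_term i + (t - var_term i)"
    using assms by (intro poly_mapping_eqI)
      (auto simp: lookup_add lookup_minus lookup_single when_def)
  have "bclass (monomial t) = bvar i * bclass (monomial (t - var_term i))"
    by (subst t) (simp add: bvar_def bclass_times mult_single)
  then show ?thesis by (metis bvar_mult_self mult.assoc)
qed

text \<open>Only multiplication by an indeterminate can destroy square-freeness. It is treated term
  by term: an indeterminate not in the term gives a square-free product, one already present is
  absorbed.\<close>

lemma squarefree_representative: "\<exists>p. squarefree_mpoly p \<and> bclass p = (f :: 'n::finite bpoly)"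
proof (induction f rule: bpoly_induct)
  case zero
  show ?case by (rule exI [of _ 0]) (simp add: squarefree_mpoly_def bclass_0)
next
  case one
  show ?case by (rule exI [of _ 1]) (simp add: squarefree_mpoly_def bclass_1)
next
  case (add f g)
  then show ?case by (metis bclass_plus squarefree_mpoly_add)
next
  case (var i f)
  then obtain p where p: "squarefree_mpoly p" "bclass p = f" by blast
  have mono: "\<exists>q. squarefree_mpoly q \<and> bclass q = bvar i * bclass (monomial t)"
    if "\<forall>j. Poly_Mapping.lookup t j \<le> 1" for t
  proof (cases "Poly_Mapping.lookup t i = 0")
    case True
    then have "squarefree_mpoly (monomial (var_term i + t))"
      using that by (auto simp: squarefree_mpoly_def lookup_add lookup_single when_def)
    moreover have "bclass (monomial (var_term i + t)) = bvar i * bclass (monomial t)"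
      by (simp add: bvar_def bclass_times mult_single)
    ultimately show ?thesis by blast
  next
    case False
    have "squarefree_mpoly (monomial t)" using that by (simp add: squarefree_mpoly_def)
    then show ?thesis using bclass_monomial_absorb [OF False] by metis
  qed
  have "\<exists>q. squarefree_mpoly q \<and>
      bclass q = bvar i * bclass (\<Sum>t\<in>T. Poly_Mapping.single t (Poly_Mapping.lookup p t))"
    if "finite T" "T \<subseteq> Poly_Mapping.keys p" for T
    using that
  proof induction
    case empty
    show ?case by (rule exI [of _ 0]) (simp add: squarefree_mpoly_def bclass_0)
  next
    case (insert t T)
    then have "\<exists>q. squarefree_mpoly q \<and> bclass q = bvar i * bclass (monomial t)"
      using p(1) by (intro mono) (auto simp: squarefree_mpoly_def)
    moreover have "Poly_Mapping.lookup p t = 1"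
      using insert by (auto simp: in_keys_iff)
    ultimately show ?case
      using insert
      by (simp flip: bclass_plus add: distrib_left) (metis bclass_plus squarefree_mpoly_add)
  qed
  from this [OF finite_keys] have
    "\<exists>q. squarefree_mpoly q \<and> bclass q = bvar i * bclass p" by (metis mpoly_as_sum order_refl)
  then show ?case using p by simp
qed

text \<open>Take a term \<open>t\<close> of \<open>p\<close> with the fewest indeterminates and
  evaluate at the characteristic vector of its indeterminates. Only square-free terms dividing
  \<open>t\<close> survive there, and by minimality \<open>t\<close> is the only one in
  \<open>p\<close>; the value is its nonzero coefficient.\<close>

lemma squarefree_mpoly_eq_0:
  fixes p :: "'n::finite mpoly"
  assumes sf: "squarefree_mpoly p" and ev: "\<And>a. mpoly_eval a p = 0"
  shows "p = 0"
proof (rule ccontr)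
  assume "p \<noteq> 0"
  then have "Poly_Mapping.keys p \<noteq> {}" by simp
  then obtain t where t: "t \<in> Poly_Mapping.keys p"
    and min: "\<And>s. s \<in> Poly_Mapping.keys p \<Longrightarrow>
      card (Poly_Mapping.keys t) \<le> card (Poly_Mapping.keys s)"
    using ex_min_if_finite[of "(\<lambda>t. card (Poly_Mapping.keys t)) ` Poly_Mapping.keys p"]
    by (auto simp: not_less)
  define a :: "'n \<Rightarrow> bit" where "a i = (if i \<in> Poly_Mapping.keys t then 1 else 0)" for i
  have ev_t: "term_eval a s = (if s = t then 1 else 0)" if s: "s \<in> Poly_Mapping.keys p" for s
  proof (cases "s = t")
    case True
    then show ?thesis
      by (auto simp: term_eval_def a_def in_keys_iff intro!: prod.neutral)
  next
    case False
    have "\<not> Poly_Mapping.keys s \<subseteq> Poly_Mapping.keys t"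
    proof
      assume "Poly_Mapping.keys s \<subseteq> Poly_Mapping.keys t"
      with min [OF s] have k: "Poly_Mapping.keys s = Poly_Mapping.keys t"
        by (intro card_seteq) auto
      have "Poly_Mapping.lookup s i = Poly_Mapping.lookup t i" for i
      proof -
        have "Poly_Mapping.lookup s i \<le> 1" "Poly_Mapping.lookup t i \<le> 1"
          using sf s t by (auto simp: squarefree_mpoly_def)
        moreover have "Poly_Mapping.lookup s i = 0 \<longleftrightarrow> Poly_Mapping.lookup t i = 0"
          using k by (metis in_keys_iff)
        ultimately show ?thesis by linarith
      qed
      with False show False by (auto intro: poly_mapping_eqI)
    qed
    then obtain i where "i \<in> Poly_Mapping.keys s" "i \<notin> Poly_Mapping.keys t" by blast
    then have "i \<in> Poly_Mapping.keys s" "a i = 0" by (simp_all add: a_def)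
    then have "a i ^ Poly_Mapping.lookup s i = 0" by (simp add: in_keys_iff)
    then have "term_eval a s = 0" unfolding term_eval_def
      by (intro prod_zero) auto
    with False show ?thesis by simp
  qed
  have "mpoly_eval a p = (\<Sum>s\<in>Poly_Mapping.keys p. if s = t then Poly_Mapping.lookup p s else 0)"
    unfolding mpoly_eval_def by (rule sum.cong) (simp_all add: ev_t)
  also have "\<dots> = Poly_Mapping.lookup p t"
    using t by simp
  finally have "mpoly_eval a p = Poly_Mapping.lookup p t" .
  with ev [of a] t show False by (simp add: in_keys_iff)
qed

text \<open>The sum of two square-free representatives of a class is square-free and lies in the
  field ideal, so it vanishes at every point and is 0. Hence the definite description in
  \<open>canonical\<close> is meaningful.\<close>

lemma canonical_props: "squarefree_mpoly (canonical f)" "bclass (canonical f) = f"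
proof -
  have unique: "p = q" if "squarefree_mpoly p" "squarefree_mpoly q" "bclass p = bclass q"
    for p q :: "'a mpoly"
  proof -
    have "p + q \<in> field_ideal"
      using that(3) by (simp add: bpoly.abs_eq_iff field_equiv_def)
    then have "p + q = 0"
      using that by (intro squarefree_mpoly_eq_0 squarefree_mpoly_add mpoly_eval_field_ideal)
    then show "p = q" by (metis add_right_cancel mpoly_add_self)
  qed
  have "\<exists>!p. squarefree_mpoly p \<and> bclass p = f"
    using squarefree_representative [of f] unique by blast
  from theI' [OF this] show "squarefree_mpoly (canonical f)" "bclass (canonical f) = f"
    by (simp_all add: canonical_def)
qed

lemma canonical_bclass:
  assumes "squarefree_mpoly p"
  shows "canonical (bclass p) = p"
proof -
  have "canonical (bclass p) + p \<in> field_ideal"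
    using canonical_props(2) [of "bclass p"] by (simp add: bpoly.abs_eq_iff field_equiv_def)
  then have "canonical (bclass p) + p = 0"
    using assms canonical_props(1)
    by (intro squarefree_mpoly_eq_0 squarefree_mpoly_add mpoly_eval_field_ideal)
  then show ?thesis by (metis add_right_cancel mpoly_add_self)
qed

lemma canonical_add: "canonical (f + g) = canonical f + canonical g"
  using canonical_bclass [of "canonical f + canonical g"]
  by (simp add: canonical_props squarefree_mpoly_add flip: bclass_plus)

lemma canonical_0 [simp]: "canonical 0 = 0"
  using canonical_bclass [of 0] by (simp add: squarefree_mpoly_def bclass_0)

lemma canonical_1 [simp]: "canonical 1 = 1"
  using canonical_bclass [of 1] by (simp add: squarefree_mpoly_def bclass_1)

lemma canonical_bvar [simp]: "canonical (bvar i) = Var i"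
  unfolding bvar_def
  by (rule canonical_bclass) (simp add: squarefree_mpoly_def lookup_single when_def)

lemma canonical_eq_iff [simp]: "canonical f = canonical g \<longleftrightarrow> f = g"
  by (metis canonical_props(2))

lemma canonical_eq_0 [simp]: "canonical f = 0 \<longleftrightarrow> f = 0"
  using canonical_eq_iff [of f 0] by simp

section \<open>Evaluation, and finiteness of the ring\<close>

lemma beval_add: "beval a (f + g) = beval a f + beval a g"
  and beval_mult: "beval a (f * g) = beval a f * beval a g"
  and beval_0 [simp]: "beval a 0 = 0"
  by (transfer, simp add: mpoly_eval_add mpoly_eval_mult)+

lemma beval_1 [simp]: "beval a 1 = 1"
  using mpoly_eval_single [of a 0 1]
  by (simp add: beval.abs_eq term_eval_def flip: bclass_1)

lemma beval_bvar [simp]: "beval a (bvar i) = a i"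
proof -
  have "term_eval a (var_term i) = (\<Prod>j\<in>UNIV. if j = i then a i else 1)"
    unfolding term_eval_def by (rule prod.cong) (auto simp: lookup_single when_def)
  then show ?thesis
    by (simp add: bvar_def beval.abs_eq mpoly_eval_single)
qed

lemma beval_inject:
  assumes "\<And>a. beval a f = beval a g"
  shows "f = g"
proof -
  have "canonical (f + g) = 0"
  proof (rule squarefree_mpoly_eq_0)
    fix a
    have "mpoly_eval a (canonical (f + g)) = beval a (f + g)"
      by (metis beval.abs_eq canonical_props(2))
    then show "mpoly_eval a (canonical (f + g)) = 0" by (simp add: beval_add assms)
  qed (rule canonical_props)
  then show ?thesis by simp
qed

instance bit :: finite
proof
  have "(UNIV :: bit set) \<subseteq> {0, 1}" by auto
  then show "finite (UNIV :: bit set)" by (rule finite_subset) simp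
qed

text \<open>A polynomial is determined by its value function, and there are finitely many of those.
  This makes every set of Boolean polynomials finite, as the inductions and cardinality arguments
  below require.\<close>

instance bpoly :: (finite) finite
proof
  have "inj (\<lambda>(f :: 'a bpoly) a. beval a f)"
    by (rule injI, rule beval_inject) (simp add: fun_eq_iff)
  then show "finite (UNIV :: 'a bpoly set)" by (rule finite_imageD [OF finite])
qed


section \<open>Ideals and their zero sets\<close>

text \<open>The interpolation polynomial of the point \<open>a\<close>: each factor is 1 exactly
  when the coordinate agrees with that of \<open>a\<close>.\<close>

definition point_indicator :: "('n::finite \<Rightarrow> bit) \<Rightarrow> 'n bpoly" where
  "point_indicator a = (\<Prod>i\<in>UNIV. if a i = 1 then bvar i else bvar i + 1)"

lemma beval_prod: "beval a (prod f A) = (\<Prod>x\<in>A. beval a (f x))"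
  by (induction A rule: infinite_finite_induct) (simp_all add: beval_mult)

lemma beval_sum: "beval a (sum f A) = (\<Sum>x\<in>A. beval a (f x))"
  by (induction A rule: infinite_finite_induct) (simp_all add: beval_add)

lemma beval_point_indicator: "beval b (point_indicator a) = (if a = b then 1 else 0)"
proof (cases "a = b")
  case True
  have "beval b (if a i = 1 then bvar i else bvar i + 1) = 1" for i
    using True by (cases "a i") (simp_all add: beval_add)
  with True show ?thesis
    by (simp add: point_indicator_def beval_prod)
next
  case False
  then obtain i where "a i \<noteq> b i" by blast
  then have "beval b (if a i = 1 then bvar i else bvar i + 1) = 0"
    by (cases "a i"; cases "b i") (simp_all add: beval_add)
  then have "beval b (point_indicator a) = 0"
    unfolding point_indicator_def beval_prod by (intro prod_zero bexI [of _ i]) simp_all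
  with False show ?thesis by simp
qed

text \<open>A Nullstellensatz over the field with two elements. A point where \<open>f\<close> is 1
  is no zero of \<open>I\<close>, so some element of \<open>I\<close> is 1 there; weighting these
  elements with point indicators recovers \<open>f\<close>.\<close>

lemma ideal_member_iff_vanishing:
  fixes I :: "'n::finite bpoly set"
  assumes I: "ideal.subspace I"
  shows "f \<in> I \<longleftrightarrow> (\<forall>a\<in>zero_set I. beval a f = 0)"
proof
  show "f \<in> I \<Longrightarrow> \<forall>a\<in>zero_set I. beval a f = 0" by (simp add: zero_set_def)
next
  assume f: "\<forall>a\<in>zero_set I. beval a f = 0"
  have "\<exists>g\<in>I. beval a g = 1" if "beval a f = 1" for a
    using f that by (force simp: zero_set_def)
  then obtain g where g: "\<And>a. beval a f = 1 \<Longrightarrow> g a \<in> I \<and> beval a (g a) = 1" by metis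
  have "f = (\<Sum>a | beval a f = 1. point_indicator a * g a)"
  proof (rule beval_inject)
    fix b
    have "beval b (\<Sum>a | beval a f = 1. point_indicator a * g a)
        = (\<Sum>a | beval a f = 1. if a = b then 1 else 0)"
      unfolding beval_sum by (rule sum.cong) (auto simp: beval_mult beval_point_indicator g)
    also have "\<dots> = beval b f" by (cases "beval b f") auto
    finally show "beval b f = beval b (\<Sum>a | beval a f = 1. point_indicator a * g a)" by simp
  qed
  also have "\<dots> \<in> I"
    using I g by (intro ideal.subspace_sum ideal.subspace_scale) auto
  finally show "f \<in> I" .
qed

text \<open>A point outside \<open>Z\<close> is excluded by its own indicator, which vanishes on
  \<open>Z\<close>.\<close>

lemma zero_set_vanishing:
  "zero_set {f. \<forall>a\<in>Z. beval a f = 0} = (Z :: ('n::finite \<Rightarrow> bit) set)"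
proof (rule set_eqI)
  fix b :: "'n \<Rightarrow> bit"
  show "b \<in> zero_set {f. \<forall>a\<in>Z. beval a f = 0} \<longleftrightarrow> b \<in> Z"
  proof (cases "b \<in> Z")
    case False
    then have "\<forall>a\<in>Z. beval a (point_indicator b) = 0"
      by (auto simp: beval_point_indicator)
    moreover have "beval b (point_indicator b) \<noteq> 0" by (simp add: beval_point_indicator)
    ultimately show ?thesis using False by (auto simp: zero_set_def)
  qed (simp add: zero_set_def)
qed

text \<open>The vanishing ideal of the satisfying assignments shows existence, the Nullstellensatz
  uniqueness; so \<open>formula_ideal\<close> is well defined and ideals can be compared by their
  zeros.\<close>

lemma formula_ideal_eq_iff:
  assumes I: "ideal.subspace I"
  shows "formula_ideal F = I \<longleftrightarrow> zero_set I = {a. sat a F}"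
proof -
  let ?I = "{f. \<forall>a\<in>{a. sat a F}. beval a f = 0}"
  have "ideal.subspace ?I"
    by (auto simp: ideal.subspace_def beval_add beval_mult)
  then have "ideal.subspace ?I \<and> zero_set ?I = {a. sat a F}"
    by (simp only: zero_set_vanishing)
  moreover have "J = ?I" if "ideal.subspace J \<and> zero_set J = {a. sat a F}" for J
    using that ideal_member_iff_vanishing [of J] by (intro set_eqI) simp
  ultimately have "\<exists>!J. ideal.subspace J \<and> zero_set J = {a. sat a F}" by blast
  then show ?thesis
    unfolding formula_ideal_def using I theI' [of "\<lambda>J. ideal.subspace J \<and> zero_set J = {a. sat a F}"]
      the1_equality [of "\<lambda>J. ideal.subspace J \<and> zero_set J = {a. sat a F}" I] by blast
qed

lemma zero_set_span: "zero_set (ideal.span S) = {a. \<forall>f\<in>S. beval a f = 0}"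
proof -
  have "beval a f = 0" if "\<forall>f\<in>S. beval a f = 0" "f \<in> ideal.span S" for a f
    using that(2) by (induction rule: ideal.span_induct_alt) (use that(1) in \<open>auto simp: beval_add beval_mult\<close>)
  then show ?thesis by (auto simp: zero_set_def intro: ideal.span_base)
qed

definition solutions :: "'n::finite bpoly set \<Rightarrow> 'n bpoly rel \<Rightarrow> ('n \<Rightarrow> bit) set" where
  "solutions L E = {a. (\<forall>f\<in>L. beval a f = 0) \<and> (\<forall>(p, q)\<in>E. beval a p = 0 \<longrightarrow> beval a q = 0)}"

text \<open>A product \<open>f * g\<close> vanishes at \<open>a\<close> iff \<open>f + 1 = 0\<close>
  forces \<open>g = 0\<close> there, which is the implication expressed by the edge.\<close>

lemma zero_set_IGS_ideal:
  "zero_set {p + q | p q. p \<in> ideal.span L \<and> q \<in> ideal.span {f * g | f g. (f + 1, g) \<in> E}}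
    = solutions L E" (is "zero_set ?I = _")
proof -
  let ?S = "{f * g | f g. (f + 1, g) \<in> E}"
  have "a \<in> zero_set (ideal.span (L \<union> ?S)) \<longleftrightarrow> a \<in> solutions L E" for a
  proof -
    have "(\<forall>f\<in>?S. beval a f = 0) \<longleftrightarrow> (\<forall>f g. (f + 1, g) \<in> E \<longrightarrow> beval a f = 1 \<longrightarrow> beval a g = 0)"
      by (force simp: beval_mult)
    also have "\<dots> \<longleftrightarrow> (\<forall>(p, q)\<in>E. beval a p = 0 \<longrightarrow> beval a q = 0)"
    proof safe
      \<comment> \<open>Every source \<open>p\<close> has the form \<open>f + 1\<close>, namely with
        \<open>f = p + 1\<close>.\<close>
      fix p q assume *: "\<forall>f g. (f + 1, g) \<in> E \<longrightarrow> beval a f = 1 \<longrightarrow> beval a g = 0"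
        and pq: "(p, q) \<in> E" "beval a p = 0"
      from pq show "beval a q = 0"
        using * [rule_format, of "p + 1" q] by (simp add: beval_add)
    qed (auto simp: beval_add split: prod.splits)
    finally show ?thesis by (auto simp: zero_set_span solutions_def)
  qed
  then show ?thesis by (auto simp: ideal.span_Un)
qed

text \<open>The working form of the definition: equality of ideals becomes equality of solution
  sets, and the symmetry condition becomes closure of \<open>E\<close> under contraposition.\<close>

lemma is_IGS_iff:
  "is_IGS F (L, V, E) \<longleftrightarrow>
     L \<subseteq> linear_bpolys \<and> V \<subseteq> linear_bpolys \<and> E \<subseteq> V \<times> V \<and> solutions L E = {a. sat a F} \<and>
     (\<forall>p q. (p, q) \<in> E \<longrightarrow> (q + 1, p + 1) \<in> E) \<and> (\<forall>f. (f, f) \<notin> E)"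
proof -
  let ?S = "{f * g | f g. (f + 1, g) \<in> E}"
  let ?I = "{p + q | p q. p \<in> ideal.span L \<and> q \<in> ideal.span ?S}"
  have "?I = ideal.span (L \<union> ?S)" by (auto simp: ideal.span_Un)
  then have "formula_ideal F = ?I \<longleftrightarrow> solutions L E = {a. sat a F}"
    using formula_ideal_eq_iff [of ?I F] zero_set_IGS_ideal [of L E] by simp
  moreover have "(\<forall>f g. (f + 1, g) \<in> E \<longrightarrow> (g + 1, f) \<in> E)
      \<longleftrightarrow> (\<forall>p q. (p, q) \<in> E \<longrightarrow> (q + 1, p + 1) \<in> E)"
  proof safe
    fix p q assume *: "\<forall>f g. (f + 1, g) \<in> E \<longrightarrow> (g + 1, f) \<in> E" and "(p, q) \<in> E"
    then show "(q + 1, p + 1) \<in> E"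
      using * [rule_format, of "p + 1" q] by simp
  next
    fix f g assume *: "\<forall>p q. (p, q) \<in> E \<longrightarrow> (q + 1, p + 1) \<in> E" and "(f + 1, g) \<in> E"
    then show "(g + 1, f) \<in> E"
      using * [rule_format, of "f + 1" g] by simp
  qed
  ultimately show ?thesis by auto
qed


section \<open>Leading terms and normal remainders of linear polynomials\<close>

text \<open>The terms of degree at most one; \<open>0\<close> is the term 1 in additive
  notation.\<close>

definition linear_terms :: "'n::finite trm set" where
  "linear_terms = insert 0 (range var_term)"

lemma finite_linear_terms: "finite linear_terms"
  by (simp add: linear_terms_def)

lemma linear_bpolys_add: "f \<in> linear_bpolys \<Longrightarrow> g \<in> linear_bpolys \<Longrightarrow> f + g \<in> linear_bpolys"
  unfolding linear_bpolys_def by (rule F2.span_add)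

lemma one_in_linear_bpolys: "1 \<in> linear_bpolys"
  unfolding linear_bpolys_def by (rule F2.span_base) simp

lemma span_linear_bpolys: "L \<subseteq> linear_bpolys \<Longrightarrow> F2.span L \<subseteq> linear_bpolys"
  unfolding linear_bpolys_def by (rule F2.span_minimal) simp_all

text \<open>Common terms cancel over the field with two elements, so supports add as symmetric
  differences.\<close>

lemma keys_mpoly_add:
  "Poly_Mapping.keys (p + q :: 'n mpoly) =
     Poly_Mapping.keys p - Poly_Mapping.keys q \<union> (Poly_Mapping.keys q - Poly_Mapping.keys p)"
proof -
  have "a + b = 1 \<longleftrightarrow> (a = 1 \<and> b = 0 \<or> b = 1 \<and> a = 0)" for a b :: bit
    by (cases a; cases b) simp_all
  then show ?thesis by (auto simp: in_keys_iff lookup_add)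
qed

lemma mpoly_eq_keysI:
  assumes "Poly_Mapping.keys p = Poly_Mapping.keys q"
  shows "p = (q :: 'n mpoly)"
proof (rule poly_mapping_eqI)
  fix k
  have "Poly_Mapping.lookup p k = 0 \<longleftrightarrow> Poly_Mapping.lookup q k = 0"
    using assms in_keys_iff [of k p] in_keys_iff [of k q] by blast
  then show "Poly_Mapping.lookup p k = Poly_Mapping.lookup q k"
    by (cases "Poly_Mapping.lookup p k"; cases "Poly_Mapping.lookup q k") simp_all
qed

lemma Supp_linear:
  assumes "f \<in> linear_bpolys"
  shows "Supp f \<subseteq> linear_terms"
  using assms unfolding linear_bpolys_def
proof (induction rule: F2.span_induct_alt)
  case base
  show ?case by (simp add: Supp_def)
next
  case (step c x y)
  have "Supp x \<subseteq> linear_terms"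
    using step(1) by (auto simp: Supp_def linear_terms_def keys_one)
  with step(2) show ?case
    by (cases c) (auto simp: Supp_def canonical_add keys_mpoly_add)
qed

lemma squarefree_linear_keys: "Poly_Mapping.keys p \<subseteq> linear_terms \<Longrightarrow> squarefree_mpoly p"
  by (force simp: squarefree_mpoly_def linear_terms_def lookup_single when_def)

lemma vanish_on_span:
  assumes "\<forall>g\<in>L. beval a g = 0" "f \<in> F2.span L"
  shows "beval a f = 0"
  using assms(2)
proof (induction rule: F2.span_induct_alt)
  case (step c x y)
  then show ?case using assms(1) by (cases c) (simp_all add: beval_add)
qed simp

section \<open>Leading terms with respect to a term ordering\<close>

context
  fixes \<sigma> :: "'n::finite trm rel"
  assumes ord: "term_ordering \<sigma>"
begin

lemma term_le_antisym: "(s, t) \<in> \<sigma> \<Longrightarrow> (t, s) \<in> \<sigma> \<Longrightarrow> s = t"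
  and term_le_trans: "(s, t) \<in> \<sigma> \<Longrightarrow> (t, u) \<in> \<sigma> \<Longrightarrow> (s, u) \<in> \<sigma>"
  and term_le_refl: "(s, s) \<in> \<sigma>"
  and term_le_total: "(s, t) \<in> \<sigma> \<or> (t, s) \<in> \<sigma>"
  and zero_term_le: "(0, t) \<in> \<sigma>"
proof -
  have po: "refl \<sigma>" "trans \<sigma>" "antisym \<sigma>" "total \<sigma>"
    using ord by (auto simp: term_ordering_def order_on_defs)
  show "(s, t) \<in> \<sigma> \<Longrightarrow> (t, s) \<in> \<sigma> \<Longrightarrow> s = t" using po(3) by (rule antisymD)
  show "(s, t) \<in> \<sigma> \<Longrightarrow> (t, u) \<in> \<sigma> \<Longrightarrow> (s, u) \<in> \<sigma>" using po(2) by (rule transD)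
  show "(s, s) \<in> \<sigma>" using po(1) by (simp add: refl_onD)
  then show "(s, t) \<in> \<sigma> \<or> (t, s) \<in> \<sigma>"
    using po(4) by (cases "s = t") (auto simp: total_on_def)
  show "(0, t) \<in> \<sigma>" using ord by (simp add: term_ordering_def)
qed

lemma mpoly_LT_eqI:
  assumes "t \<in> Poly_Mapping.keys p" "\<And>s. s \<in> Poly_Mapping.keys p \<Longrightarrow> (s, t) \<in> \<sigma>"
  shows "mpoly_LT \<sigma> p = t"
  unfolding mpoly_LT_def by (rule the_equality) (use assms term_le_antisym in blast)+

lemma mpoly_LT_max:
  assumes "p \<noteq> 0"
  shows "mpoly_LT \<sigma> p \<in> Poly_Mapping.keys p"
    and "s \<in> Poly_Mapping.keys p \<Longrightarrow> (s, mpoly_LT \<sigma> p) \<in> \<sigma>"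
proof -
  have "\<exists>t\<in>T. \<forall>s\<in>T. (s, t) \<in> \<sigma>" if "finite T" "T \<noteq> {}" for T
    using that
  proof (induction rule: finite_ne_induct)
    case (singleton x)
    show ?case using term_le_refl by simp
  next
    case (insert x T)
    then obtain t where t: "t \<in> T" "\<forall>s\<in>T. (s, t) \<in> \<sigma>" by blast
    show ?case
    proof (cases "(x, t) \<in> \<sigma>")
      case True
      with t show ?thesis by blast
    next
      case False
      then have "(t, x) \<in> \<sigma>" using term_le_total by blast
      with t have "\<forall>s\<in>insert x T. (s, x) \<in> \<sigma>" using term_le_refl term_le_trans by blast
      then show ?thesis by blast
    qed
  qed
  from this [of "Poly_Mapping.keys p"] assms obtain t
    where t: "t \<in> Poly_Mapping.keys p" "\<forall>s\<in>Poly_Mapping.keys p. (s, t) \<in> \<sigma>" by auto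
  then have "mpoly_LT \<sigma> p = t" by (intro mpoly_LT_eqI) auto
  with t show "mpoly_LT \<sigma> p \<in> Poly_Mapping.keys p"
    and "s \<in> Poly_Mapping.keys p \<Longrightarrow> (s, mpoly_LT \<sigma> p) \<in> \<sigma>" by auto
qed

lemma LT_in_Supp: "f \<noteq> 0 \<Longrightarrow> LT \<sigma> f \<in> Supp f"
  using mpoly_LT_max(1) [of "canonical f"] by (simp add: LT_def Supp_def)

lemma mpoly_LT_add_distinct:
  assumes "p \<noteq> 0" "q \<noteq> 0" "mpoly_LT \<sigma> p \<noteq> mpoly_LT \<sigma> q"
  shows "mpoly_LT \<sigma> (p + q) \<in> {mpoly_LT \<sigma> p, mpoly_LT \<sigma> q}"
proof -
  \<comment> \<open>The larger leading term cannot cancel, since it lies above all terms of the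
    other summand; by symmetry it is taken to be that of \<open>q\<close>.\<close>
  have *: "mpoly_LT \<sigma> (p + q) = mpoly_LT \<sigma> q"
    if "p \<noteq> 0" "q \<noteq> 0" "mpoly_LT \<sigma> p \<noteq> mpoly_LT \<sigma> q" "(mpoly_LT \<sigma> p, mpoly_LT \<sigma> q) \<in> \<sigma>" for p q
  proof (rule mpoly_LT_eqI)
    show "mpoly_LT \<sigma> q \<in> Poly_Mapping.keys (p + q)"
      using that mpoly_LT_max term_le_antisym by (fastforce simp: keys_mpoly_add)
    show "(s, mpoly_LT \<sigma> q) \<in> \<sigma>" if s: "s \<in> Poly_Mapping.keys (p + q)" for s
      using s mpoly_LT_max(2) [OF \<open>p \<noteq> 0\<close>, of s] mpoly_LT_max(2) [OF \<open>q \<noteq> 0\<close>, of s]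
        \<open>(mpoly_LT \<sigma> p, mpoly_LT \<sigma> q) \<in> \<sigma>\<close> term_le_trans
      unfolding keys_mpoly_add by blast
  qed
  show ?thesis
    using term_le_total [of "mpoly_LT \<sigma> p" "mpoly_LT \<sigma> q"] * [of p q] * [of q p] assms
    by (auto simp: add.commute)
qed

text \<open>Equal leading terms cancel and only smaller terms remain; this is the descent in both
  interreduction and division.\<close>

lemma keys_add_same_LT:
  assumes "p \<noteq> 0" "q \<noteq> 0" "mpoly_LT \<sigma> p = mpoly_LT \<sigma> q" "s \<in> Poly_Mapping.keys (p + q)"
  shows "(s, mpoly_LT \<sigma> p) \<in> \<sigma>" "s \<noteq> mpoly_LT \<sigma> p"
  using assms mpoly_LT_max [of p] mpoly_LT_max [of q] by (auto simp: keys_mpoly_add)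

text \<open>Induction on \<open>L\<close>. If \<open>f\<close> involves \<open>g\<close>, it is
  \<open>h + g\<close> with \<open>h\<close> in the span of the other elements. The leading term of
  a nonzero \<open>h\<close> then comes from those elements, so it differs from that of
  \<open>g\<close> and no cancellation of leading terms occurs.\<close>

lemma LT_span:
  assumes L: "distinct_LTs \<sigma> L" and f: "f \<in> F2.span L" "f \<noteq> 0"
  shows "LT \<sigma> f \<in> LT \<sigma> ` L"
proof -
  have "finite L" by simp
  then show ?thesis using assms
  proof (induction L arbitrary: f)
    case (insert g L)
    from insert.prems(1) have g: "g \<noteq> 0" "LT \<sigma> g \<notin> LT \<sigma> ` L" and L: "distinct_LTs \<sigma> L"
      using insert.hyps by (auto simp: distinct_LTs_def)
    from insert.prems(2) obtain k where k: "f - bscale k g \<in> F2.span L"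
      by (auto simp: F2.span_insert)
    show ?case
    proof (cases k)
      assume "k = 0"
      with k L insert.IH [of f] insert.prems show ?thesis by simp
    next
      assume k1: "k = 1"
      define h where "h = f + g"
      have h: "h \<in> F2.span L" using k k1 by (simp add: h_def)
      have f: "f = h + g" by (simp add: h_def)
      show ?thesis
      proof (cases "h = 0")
        case True
        then show ?thesis by (simp add: f)
      next
        case False
        with h L have "LT \<sigma> h \<in> LT \<sigma> ` L" using insert.IH by blast
        moreover from this g have "LT \<sigma> h \<noteq> LT \<sigma> g" by auto
        with False g(1) have "LT \<sigma> f \<in> {LT \<sigma> h, LT \<sigma> g}"
          unfolding LT_def f canonical_add by (intro mpoly_LT_add_distinct) auto
        ultimately show ?thesis by auto
      qed
    qed
  qed simp
qed

text \<open>A nonzero \<open>f\<close> in the span would have its leading term both in its support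
  and among those of \<open>L\<close>. Uniqueness of remainders and strict growth of spans both rest
  on this.\<close>

lemma span_disjoint_Supp:
  assumes "distinct_LTs \<sigma> L" "f \<in> F2.span L" "Supp f \<inter> LT \<sigma> ` L = {}"
  shows "f = 0"
  using assms LT_span LT_in_Supp by blast

text \<open>Gaussian elimination without an explicit algorithm: choose one element of the span for
  each leading term that occurs in it, and reduce any other element by the chosen ones.\<close>

lemma LT_interreduction_exists: "\<exists>B. LT_interreduction \<sigma> L B"
proof -
  define U where "U = F2.span L"
  define T where "T = LT \<sigma> ` (U - {0})"
  have "\<forall>t\<in>T. \<exists>g. g \<in> U \<and> g \<noteq> 0 \<and> LT \<sigma> g = t" by (auto simp: T_def)
  then obtain b where b: "\<And>t. t \<in> T \<Longrightarrow> b t \<in> U \<and> b t \<noteq> 0 \<and> LT \<sigma> (b t) = t" by metis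
  have fin: "finite T" by (simp add: T_def)
  have "f \<in> F2.span (b ` T)" if "f \<in> U" for f
    using that
  \<comment> \<open>The descent counts the leading terms in the finite set \<open>T\<close> that are
    at most that of \<open>f\<close>.\<close>
  proof (induction "card {s \<in> T. (s, LT \<sigma> f) \<in> \<sigma>}" arbitrary: f rule: less_induct)
    case less
    show ?case
    proof (cases "f = 0")
      case True
      then show ?thesis by (simp add: F2.span_zero)
    next
      case False
      let ?g = "b (LT \<sigma> f)" and ?h = "f + b (LT \<sigma> f)"
      have t: "LT \<sigma> f \<in> T" using False less by (auto simp: T_def)
      have h: "?h \<in> U" using less(2) b [OF t] unfolding U_def by (intro F2.span_add) auto
      have "?h \<in> F2.span (b ` T)"
      \<comment> \<open>The zero polynomial has no leading term, so it is split off before the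
        descent.\<close>
      proof (cases "?h = 0")
        case True
        then show ?thesis by (simp add: F2.span_zero del: bpoly_add_eq_0)
      next
        case nz: False
        have "LT \<sigma> ?h \<in> Poly_Mapping.keys (canonical f + canonical ?g)"
          using LT_in_Supp [OF nz] by (simp add: Supp_def canonical_add)
        moreover have "mpoly_LT \<sigma> (canonical f) = mpoly_LT \<sigma> (canonical ?g)"
          using b [OF t] by (metis LT_def)
        ultimately have lt: "(LT \<sigma> ?h, LT \<sigma> f) \<in> \<sigma>" "LT \<sigma> ?h \<noteq> LT \<sigma> f"
          using keys_add_same_LT [of "canonical f" "canonical ?g" "LT \<sigma> ?h"] False b [OF t]
          unfolding LT_def [of \<sigma> f] canonical_eq_0 by blast+
        have "{s \<in> T. (s, LT \<sigma> ?h) \<in> \<sigma>} \<subseteq> {s \<in> T. (s, LT \<sigma> f) \<in> \<sigma>}"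
          using lt(1) term_le_trans by blast
        moreover have "LT \<sigma> f \<in> {s \<in> T. (s, LT \<sigma> f) \<in> \<sigma>} - {s \<in> T. (s, LT \<sigma> ?h) \<in> \<sigma>}"
          using lt term_le_antisym term_le_refl t by blast
        ultimately have "{s \<in> T. (s, LT \<sigma> ?h) \<in> \<sigma>} \<subset> {s \<in> T. (s, LT \<sigma> f) \<in> \<sigma>}" by blast
        then show ?thesis using less(1) [OF _ h] fin by (simp add: psubset_card_mono)
      qed
      moreover have "?g \<in> F2.span (b ` T)" using t by (intro F2.span_base) auto
      ultimately have "?h + ?g \<in> F2.span (b ` T)" by (rule F2.span_add)
      then show ?thesis by simp
    qed
  qed
  moreover have "F2.span (b ` T) \<subseteq> U"
    unfolding U_def by (rule F2.span_minimal) (use b in \<open>auto simp: U_def\<close>)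
  ultimately have "F2.span (b ` T) = F2.span L" by (auto simp: U_def)
  moreover have "distinct_LTs \<sigma> (b ` T)"
    using b by (fastforce simp: distinct_LTs_def inj_on_def)
  ultimately show ?thesis by (auto simp: LT_interreduction_def)
qed

text \<open>The term 1, written \<open>0\<close>, is the smallest term, so no other term can lie
  below it in the support.\<close>

lemma LT_eq_zero_term:
  assumes "g \<noteq> 0" "LT \<sigma> g = 0"
  shows "g = 1"
proof -
  have "s = 0" if "s \<in> Supp g" for s
    using that assms mpoly_LT_max(2) [of "canonical g" s] zero_term_le term_le_antisym
    by (auto simp: LT_def Supp_def)
  moreover have "0 \<in> Supp g" using LT_in_Supp [OF assms(1)] assms(2) by simp
  ultimately have "Poly_Mapping.keys (canonical g) = {0}"
    by (auto simp: Supp_def)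
  then have "canonical g = 1"
    by (intro mpoly_eq_keysI) (simp add: keys_one)
  then show ?thesis by (metis canonical_1 canonical_eq_iff)
qed

lemma LT_one: "LT \<sigma> 1 = 0"
  unfolding LT_def by (rule mpoly_LT_eqI) (simp_all add: term_le_refl)

section \<open>Division by linear polynomials with distinct leading terms\<close>

context
  fixes L :: "'n bpoly set"
  assumes L: "distinct_LTs \<sigma> L" "L \<subseteq> linear_bpolys"
begin

text \<open>Every term is divisible by the leading term of \<open>1\<close>.\<close>

lemma NR_one_mem:
  assumes "1 \<in> L"
  shows "NR \<sigma> f L = 0"
proof -
  let ?D = "canonical ` L"
  have red: "1 \<in> ?D" "mpoly_LT \<sigma> v = mpoly_LT \<sigma> v + mpoly_LT \<sigma> 1" for v
    using assms LT_one by (auto simp: LT_def image_iff intro: bexI [of _ 1])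
  have ex: "(division_step \<sigma> ?D)\<^sup>*\<^sup>* (v, 0) (0, 0)" for v
  proof (induction "card (Poly_Mapping.keys v)" arbitrary: v rule: less_induct)
    case less
    show ?case
    proof (cases "v = 0")
      case False
      let ?v = "v - monomial (mpoly_LT \<sigma> v) * 1"
      have "Poly_Mapping.keys ?v = Poly_Mapping.keys v - {mpoly_LT \<sigma> v}"
        using mpoly_LT_max(1) [OF False] by (auto simp: keys_mpoly_add)
      then have "card (Poly_Mapping.keys ?v) < card (Poly_Mapping.keys v)"
        using mpoly_LT_max(1) [OF False] by (simp only: card_Diff1_less finite_keys)
      then have "(division_step \<sigma> ?D)\<^sup>*\<^sup>* (?v, 0) (0, 0)" by (rule less)
      moreover have "division_step \<sigma> ?D (v, 0) (?v, 0)"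
        using False red by (intro division_step.reduce) auto
      ultimately show ?thesis by (rule converse_rtranclp_into_rtranclp [rotated])
    qed simp
  qed
  have "r = 0" if "(division_step \<sigma> ?D)\<^sup>*\<^sup>* (canonical f, 0) (0, r)" for r
  proof -
    \<comment> \<open>A leading term is always divisible by that of 1, so the rule
      \<open>move\<close> never applies and the partial remainder stays 0.\<close>
    have "snd s = 0" if "(division_step \<sigma> ?D)\<^sup>*\<^sup>* (canonical f, 0) s" for s
      using that
    proof induction
      case (step s t)
      from step(2,3) show ?case
      proof cases
        case (move v r)
        then show ?thesis using red by (metis zero_neq_one)
      qed simp
    qed simp
    from this [OF that] show ?thesis by simp
  qed
  with ex have "(THE r. (division_step \<sigma> ?D)\<^sup>*\<^sup>* (canonical f, 0) (0, r)) = 0"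
    by (intro the_equality) auto
  then show ?thesis by (simp add: NR_def bclass_0)
qed

text \<open>Excluding 1 leaves only indeterminates as leading terms of \<open>L\<close>, and the
  only linear term divisible by an indeterminate is that indeterminate. Hence each reduction
  subtracts an element of \<open>L\<close> itself and the division stays linear.\<close>

lemma LT_divides_linear_term:
  assumes "1 \<notin> L" "g \<in> L" "t \<in> linear_terms" "t = u + LT \<sigma> g"
  shows "u = 0"
proof -
  have "g \<noteq> 0" using L assms by (auto simp: distinct_LTs_def)
  then have "LT \<sigma> g \<noteq> 0" using LT_eq_zero_term assms by blast
  moreover have "LT \<sigma> g \<in> linear_terms"
    using LT_in_Supp [OF \<open>g \<noteq> 0\<close>] Supp_linear L assms by blast
  ultimately obtain j where j: "LT \<sigma> g = var_term j" by (auto simp: linear_terms_def)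
  have "Poly_Mapping.lookup t j = Poly_Mapping.lookup u j + 1"
    using assms j by (simp add: lookup_add)
  then have "t = var_term j"
    using assms(3) by (auto simp: linear_terms_def lookup_single when_def split: if_splits)
  then show ?thesis using assms(4) j by simp
qed

text \<open>The loop invariant of the division of \<open>f\<close>. Linear terms keep all
  intermediate polynomials square-free, so passing to classes loses nothing.\<close>

definition division_inv :: "'n bpoly \<Rightarrow> 'n mpoly \<times> 'n mpoly \<Rightarrow> bool" where
  "division_inv f s \<longleftrightarrow> (case s of (v, r) \<Rightarrow>
     Poly_Mapping.keys v \<subseteq> linear_terms \<and> Poly_Mapping.keys r \<subseteq> linear_terms \<and>
     f + (bclass v + bclass r) \<in> F2.span L \<and> Poly_Mapping.keys r \<inter> LT \<sigma> ` L = {})"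

text \<open>A reduction changes the dividend by an element of \<open>L\<close>, hence
  \<open>f + v + r\<close> by an element of the span; a move leaves \<open>v + r\<close>
  unchanged.\<close>

lemma division_inv_step:
  assumes "1 \<notin> L" and "division_step \<sigma> (canonical ` L) s s'" and inv: "division_inv f s"
  shows "division_inv f s'"
  using assms(2)
proof cases
  case (reduce v g u r)
  then obtain g' where g: "g = canonical g'" "g' \<in> L" by blast
  have v: "Poly_Mapping.keys v \<subseteq> linear_terms" using inv reduce by (simp add: division_inv_def)
  have "u = 0"
    using assms(1) g reduce v mpoly_LT_max(1) [of v]
    by (intro LT_divides_linear_term [of g' "mpoly_LT \<sigma> v"]) (auto simp: LT_def)
  then have "monomial u * g = g" by simp
  moreover have "Poly_Mapping.keys g \<subseteq> linear_terms"
    using Supp_linear [of g'] g L by (auto simp: Supp_def)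
  moreover have "f + (bclass (v + g) + bclass r) \<in> F2.span L"
  proof -
    have "f + (bclass (v + g) + bclass r) = (f + (bclass v + bclass r)) + g'"
      using g by (simp add: canonical_props algebra_simps flip: bclass_plus)
    also have "\<dots> \<in> F2.span L"
      using inv reduce(1) F2.span_base [OF g(2)] by (simp add: division_inv_def F2.span_add)
    finally show ?thesis .
  qed
  ultimately show ?thesis
    using inv reduce v by (auto simp: division_inv_def keys_mpoly_add)
next
  case (move v r)
  let ?t = "mpoly_LT \<sigma> v"
  have "?t \<in> linear_terms"
    using inv move mpoly_LT_max(1) [of v] by (auto simp: division_inv_def)
  moreover have "?t \<notin> LT \<sigma> ` L"
  proof
    assume "?t \<in> LT \<sigma> ` L"
    then obtain g where g: "g \<in> L" "?t = LT \<sigma> g" by blast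
    then have "g \<noteq> 0" using L by (auto simp: distinct_LTs_def)
    moreover have "?t = 0 + mpoly_LT \<sigma> (canonical g)" using g by (simp add: LT_def)
    ultimately show False using move(4) g by (metis canonical_eq_0 imageI)
  qed
  moreover have "bclass (v + monomial ?t) + bclass (r + monomial ?t) = bclass v + bclass r"
    by (simp flip: bclass_plus add: algebra_simps)
  ultimately show ?thesis
    using inv move(1,2) by (simp add: division_inv_def keys_mpoly_add) blast
qed

text \<open>Both rules cancel the leading term of the dividend, so fewer linear terms lie at or
  below one of its terms. This yields one complete run; that all complete runs agree follows from
  uniqueness of remainders.\<close>

lemma division_terminates:
  assumes "1 \<notin> L" "Poly_Mapping.keys v \<subseteq> linear_terms"
  shows "\<exists>r'. (division_step \<sigma> (canonical ` L))\<^sup>*\<^sup>* (v, r) (0, r')"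
  using assms(2)
proof (induction "card {s \<in> linear_terms. \<exists>t\<in>Poly_Mapping.keys v. (s, t) \<in> \<sigma>}"
    arbitrary: v r rule: less_induct)
  case less
  let ?D = "canonical ` L" and ?t = "mpoly_LT \<sigma> v"
  show ?case
  proof (cases "v = 0")
    case True
    then show ?thesis by blast
  next
    case False
    have t: "?t \<in> linear_terms" "?t \<in> Poly_Mapping.keys v"
      using mpoly_LT_max(1) [OF False] less by auto
    \<comment> \<open>The two rules are treated together: each adds some \<open>q\<close> with the
      same leading term as \<open>v\<close>.\<close>
    have next_v: ?thesis
      if step: "division_step \<sigma> ?D (v, r) (v + q, r')"
        and q: "Poly_Mapping.keys q \<subseteq> linear_terms" "q \<noteq> 0" "mpoly_LT \<sigma> q = ?t" for q r'
    proof -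
      have lt: "(s, ?t) \<in> \<sigma>" "s \<noteq> ?t" if "s \<in> Poly_Mapping.keys (v + q)" for s
        using keys_add_same_LT [OF False q(2) q(3) [symmetric] that] by auto
      let ?S = "\<lambda>v. {s \<in> linear_terms. \<exists>t\<in>Poly_Mapping.keys v. (s, t) \<in> \<sigma>}"
      have "?S (v + q) \<subseteq> ?S v" using lt t term_le_trans by blast
      moreover have "?t \<in> ?S v - ?S (v + q)" using lt t term_le_refl term_le_antisym by blast
      ultimately have "?S (v + q) \<subset> ?S v" by blast
      then have "card (?S (v + q)) < card (?S v)"
        by (intro psubset_card_mono) (simp_all add: finite_linear_terms)
      moreover have "Poly_Mapping.keys (v + q) \<subseteq> linear_terms"
        using less(2) q by (auto simp: keys_mpoly_add)
      ultimately obtain r'' where "(division_step \<sigma> ?D)\<^sup>*\<^sup>* (v + q, r') (0, r'')"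
        using less(1) by blast
      with step show ?thesis by (blast intro: converse_rtranclp_into_rtranclp)
    qed
    show ?thesis
    proof (cases "\<exists>g u. g \<in> ?D \<and> g \<noteq> 0 \<and> ?t = u + mpoly_LT \<sigma> g")
      case True
      then obtain g u where g: "g \<in> L" "canonical g \<noteq> 0" "?t = u + LT \<sigma> g"
        by (auto simp: LT_def)
      then have "u = 0" using assms(1) t LT_divides_linear_term by blast
      with g have tg: "?t = mpoly_LT \<sigma> (canonical g)" by (simp add: LT_def)
      have "division_step \<sigma> ?D (v, r) (v - monomial 0 * canonical g, r)"
        using False g tg by (intro division_step.reduce) auto
      then show ?thesis
        using next_v [of "canonical g" r] g tg Supp_linear [of g] L by (auto simp: Supp_def)
    next
      case none: False
      have "division_step \<sigma> ?D (v, r) (v - monomial ?t, r + monomial ?t)"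
        using False none by (rule division_step.move)
      moreover have "mpoly_LT \<sigma> (monomial ?t) = ?t"
        by (rule mpoly_LT_eqI) (auto simp: term_le_refl)
      moreover have "monomial ?t \<noteq> 0" by (metis keys_eq_empty keys_single insert_not_empty zero_neq_one)
      ultimately show ?thesis using next_v [of "monomial ?t"] t by auto
    qed
  qed
qed

text \<open>The sum of two remainders lies in the span of \<open>L\<close>, yet its support avoids
  the leading terms of \<open>L\<close>.\<close>

lemma remainder_unique:
  assumes "f + r \<in> F2.span L" "Supp r \<inter> LT \<sigma> ` L = {}"
    and "f + r' \<in> F2.span L" "Supp r' \<inter> LT \<sigma> ` L = {}"
  shows "r = r'"
proof -
  have "(f + r) + (f + r') \<in> F2.span L" using assms(1,3) by (rule F2.span_add)
  then have "r + r' \<in> F2.span L" by (simp add: algebra_simps)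
  moreover have "Supp (r + r') \<inter> LT \<sigma> ` L = {}"
    using assms by (auto simp: Supp_def canonical_add keys_mpoly_add)
  ultimately have "r + r' = 0" using L by (intro span_disjoint_Supp)
  then show ?thesis by simp
qed

text \<open>All complete runs end with the same \<open>r\<close>: its class is unique by
  \<open>remainder_unique\<close>, and \<open>r\<close> is the canonical representative of that
  class. So the definite description in \<open>NR\<close> inherits the invariant.\<close>

lemma NR_props:
  assumes "1 \<notin> L" "f \<in> linear_bpolys"
  shows "f + NR \<sigma> f L \<in> F2.span L" "Supp (NR \<sigma> f L) \<inter> LT \<sigma> ` L = {}"
proof -
  let ?run = "\<lambda>r. (division_step \<sigma> (canonical ` L))\<^sup>*\<^sup>* (canonical f, 0) (0, r)"
  have start: "division_inv f (canonical f, 0)"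
    using Supp_linear [OF assms(2)]
    by (auto simp: division_inv_def Supp_def bclass_0 canonical_props F2.span_zero)
  have "division_inv f s" if "(division_step \<sigma> (canonical ` L))\<^sup>*\<^sup>* (canonical f, 0) s" for s
    using that start by (induction) (auto intro: division_inv_step [OF assms(1)])
  then have inv: "division_inv f (0, r)" if "?run r" for r using that by blast
  have sq: "canonical (bclass r) = r" if "?run r" for r
    using inv [OF that] by (intro canonical_bclass squarefree_linear_keys) (simp add: division_inv_def)
  have props: "f + bclass r \<in> F2.span L" "Supp (bclass r) \<inter> LT \<sigma> ` L = {}" if "?run r" for r
    using inv [OF that] sq [OF that] by (auto simp: division_inv_def bclass_0 Supp_def)
  obtain r where r: "?run r"
    using division_terminates [OF assms(1), of "canonical f" 0] Supp_linear [OF assms(2)]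
    by (auto simp: Supp_def)
  have "r' = r" if "?run r'" for r'
    using remainder_unique [OF props [OF that] props [OF r]] sq [OF that] sq [OF r] by metis
  with r have "(THE r. ?run r) = r" by (rule the_equality)
  then have "NR \<sigma> f L = bclass r" by (simp add: NR_def)
  with props [OF r] show "f + NR \<sigma> f L \<in> F2.span L" "Supp (NR \<sigma> f L) \<inter> LT \<sigma> ` L = {}"
    by simp_all
qed

lemma NR_linear:
  assumes "f \<in> linear_bpolys"
  shows "NR \<sigma> f L \<in> linear_bpolys"
proof (cases "1 \<in> L")
  case True
  then show ?thesis by (simp add: NR_one_mem linear_bpolys_def F2.span_zero)
next
  case False
  then have "f + NR \<sigma> f L \<in> linear_bpolys"
    using NR_props(1) assms span_linear_bpolys [OF L(2)] by blast
  with assms have "f + (f + NR \<sigma> f L) \<in> linear_bpolys" by (rule linear_bpolys_add)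
  then show ?thesis by simp
qed

lemma zero_notin_LTs:
  assumes "1 \<notin> L"
  shows "0 \<notin> LT \<sigma> ` L"
proof
  assume "0 \<in> LT \<sigma> ` L"
  then obtain g where g: "g \<in> L" "LT \<sigma> g = 0" by auto
  then have "g = 1" using L(1) by (intro LT_eq_zero_term) (auto simp: distinct_LTs_def)
  with g assms show False by simp
qed

text \<open>Adding 1 toggles only the term \<open>0\<close>, which is no leading term of
  \<open>L\<close>, so \<open>NR \<sigma> f L + 1\<close> is still a remainder; uniqueness does the
  rest.\<close>

lemma NR_add_one:
  assumes "1 \<notin> L" "f \<in> linear_bpolys"
  shows "NR \<sigma> (f + 1) L = NR \<sigma> f L + 1"
proof (rule remainder_unique [of "f + 1"])
  have f1: "f + 1 \<in> linear_bpolys"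
    using assms(2) one_in_linear_bpolys by (rule linear_bpolys_add)
  show "f + 1 + NR \<sigma> (f + 1) L \<in> F2.span L" "Supp (NR \<sigma> (f + 1) L) \<inter> LT \<sigma> ` L = {}"
    using NR_props [OF assms(1) f1] by simp_all
  show "f + 1 + (NR \<sigma> f L + 1) \<in> F2.span L"
    using NR_props(1) [OF assms] by (simp add: algebra_simps)
  show "Supp (NR \<sigma> f L + 1) \<inter> LT \<sigma> ` L = {}"
    using NR_props(2) [OF assms] zero_notin_LTs [OF assms(1)]
    by (auto simp: Supp_def canonical_add keys_mpoly_add)
qed

text \<open>A common zero of \<open>L\<close> rules out \<open>1 \<in> L\<close> and annihilates
  \<open>f + NR \<sigma> f L\<close>, which lies in the span.\<close>

lemma beval_NR:
  assumes f: "f \<in> linear_bpolys" and a: "\<forall>g\<in>L. beval a g = 0"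
  shows "beval a (NR \<sigma> f L) = beval a f"
proof -
  have "1 \<notin> L" using a by auto
  then have "beval a (f + NR \<sigma> f L) = 0"
    using NR_props(1) [OF _ f] a vanish_on_span by blast
  then show ?thesis by (cases "beval a f"; cases "beval a (NR \<sigma> f L)") (simp_all add: beval_add)
qed

end

end


section \<open>One pass of GGCP\<close>

lemma solutions_span_cong:
  assumes "F2.span L = F2.span L'"
  shows "solutions L E = solutions L' E"
proof -
  have "(\<forall>f\<in>L. beval a f = 0) \<longleftrightarrow> (\<forall>f\<in>L'. beval a f = 0)" for a
    using assms vanish_on_span [of L a] vanish_on_span [of L' a] F2.span_base by metis
  then show ?thesis by (simp add: solutions_def)
qed

lemma solutions_path:
  assumes "a \<in> solutions L E" "(p, q) \<in> E\<^sup>*" "beval a p = 0"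
  shows "beval a q = 0"
  using assms(2,3) by (induction rule: rtrancl_induct) (use assms(1) in \<open>auto simp: solutions_def\<close>)

lemma igs_le_trans: "G'' \<preceq> G' \<Longrightarrow> G' \<preceq> G \<Longrightarrow> G'' \<preceq> G"
  by (cases G; cases G'; cases G'') auto

lemma not_in_span_psubset:
  "L \<subseteq> L' \<Longrightarrow> h \<in> L' \<Longrightarrow> h \<notin> F2.span L \<Longrightarrow> F2.span L \<subset> F2.span L'"
  using F2.span_mono [of L L'] F2.span_base [of h L'] by blast

context
  fixes \<sigma> :: "'n::finite trm rel" and F :: "'n xnf" and L V E L\<^sub>0 L' V' E'
  assumes ord: "term_ordering \<sigma>"
    and igs: "is_IGS F (L, V, E)"
    and red: "LT_interreduction \<sigma> L L\<^sub>0"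
    and pass: "GGCP_pass \<sigma> L\<^sub>0 E = (L', V', E')"
begin

lemma interreduced_linear: "distinct_LTs \<sigma> L\<^sub>0" "L\<^sub>0 \<subseteq> linear_bpolys"
proof -
  show "distinct_LTs \<sigma> L\<^sub>0" using red by (simp add: LT_interreduction_def)
  have "F2.span L\<^sub>0 \<subseteq> linear_bpolys"
    using red igs span_linear_bpolys [of L] by (simp add: LT_interreduction_def is_IGS_iff)
  then show "L\<^sub>0 \<subseteq> linear_bpolys" using F2.span_superset by blast
qed

lemma pass_components:
  "L' = L\<^sub>0 \<union> {NR \<sigma> g L\<^sub>0 | f g. (f, g) \<in> E \<and> NR \<sigma> f L\<^sub>0 = 0 \<and> NR \<sigma> g L\<^sub>0 \<noteq> 0}
     \<union> {NR \<sigma> f L\<^sub>0 + 1 | f g. (f, g) \<in> E \<and> NR \<sigma> g L\<^sub>0 = 1 \<and> NR \<sigma> f L\<^sub>0 \<noteq> 1}"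
  "E' = {(NR \<sigma> f L\<^sub>0, NR \<sigma> g L\<^sub>0) | f g. (f, g) \<in> E \<and>
     NR \<sigma> f L\<^sub>0 \<notin> {0, 1} \<and> NR \<sigma> g L\<^sub>0 \<notin> {0, 1} \<and> NR \<sigma> f L\<^sub>0 \<noteq> NR \<sigma> g L\<^sub>0}"
  "V' = Field E'"
  using pass by (auto simp: Let_def)

lemma edges_linear: "(f, g) \<in> E \<Longrightarrow> f \<in> linear_bpolys \<and> g \<in> linear_bpolys"
  using igs unfolding is_IGS_iff by blast

lemmas NR_lin = NR_linear [OF ord interreduced_linear]

lemma pass_linear: "L' \<subseteq> linear_bpolys" "V' \<subseteq> linear_bpolys"
proof -
  have "NR \<sigma> f L\<^sub>0 \<in> linear_bpolys" "NR \<sigma> f L\<^sub>0 + 1 \<in> linear_bpolys" if "f \<in> linear_bpolys" for f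
    using NR_lin [OF that] one_in_linear_bpolys linear_bpolys_add by blast+
  then show "L' \<subseteq> linear_bpolys" "V' \<subseteq> linear_bpolys"
    unfolding pass_components Field_def using interreduced_linear(2) edges_linear by blast+
qed

lemma pass_solutions: "solutions L' E' = solutions L E"
proof -
  have "a \<in> solutions L' E' \<longleftrightarrow> a \<in> solutions L\<^sub>0 E" for a
  proof (cases "\<forall>h\<in>L\<^sub>0. beval a h = 0")
    case False
    then show ?thesis by (auto simp: solutions_def pass_components(1))
  next
    case True
    have NR: "beval a (NR \<sigma> f L\<^sub>0) = beval a f" if "f \<in> linear_bpolys" for f
      using beval_NR [OF ord interreduced_linear that True] .
    show ?thesis
    proof
      assume a: "a \<in> solutions L' E'"
      have "beval a g = 0" if e: "(f, g) \<in> E" and f: "beval a f = 0" for f g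
      proof -
        let ?f = "NR \<sigma> f L\<^sub>0" and ?g = "NR \<sigma> g L\<^sub>0"
        have ev: "beval a ?f = 0" "beval a ?g = beval a g" using e f NR edges_linear by auto
        then have "?f \<noteq> 1" by auto
        \<comment> \<open>An edge missing from \<open>E'\<close> is trivial, or its content is a
          polynomial in \<open>L'\<close>; the case \<open>?f = 1\<close> cannot occur because
          \<open>f\<close> vanishes at \<open>a\<close>.\<close>
        consider "?g = 0" | "?f = 0" "?g \<noteq> 0" | "?g = 1" | "?f = ?g"
          | "?f \<notin> {0, 1}" "?g \<notin> {0, 1}" "?f \<noteq> ?g" using \<open>?f \<noteq> 1\<close> by auto
        then have "beval a ?g = 0"
        proof cases
          case 2
          then have "?g \<in> L'" unfolding pass_components(1) using e by blast
          then show ?thesis using a by (simp add: solutions_def)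
        next
          case 3
          then have "?f + 1 \<in> L'" unfolding pass_components(1) using e \<open>?f \<noteq> 1\<close> by blast
          then have "beval a (?f + 1) = 0" using a by (simp add: solutions_def)
          then show ?thesis using ev by (simp add: beval_add)
        next
          case 5
          then have "(?f, ?g) \<in> E'" unfolding pass_components(2) using e by blast
          then show ?thesis using a ev by (auto simp: solutions_def)
        qed (use ev in simp_all)
        then show ?thesis using ev by simp
      qed
      then show "a \<in> solutions L\<^sub>0 E" using True by (auto simp: solutions_def)
    next
      assume a: "a \<in> solutions L\<^sub>0 E"
      have imp: "beval a (NR \<sigma> f L\<^sub>0) = 0 \<Longrightarrow> beval a (NR \<sigma> g L\<^sub>0) = 0" if "(f, g) \<in> E" for f g
        using a that NR edges_linear [OF that] by (auto simp: solutions_def)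
      have "beval a h = 0" if "h \<in> L'" for h
        using that unfolding pass_components(1)
      proof (elim UnE)
        assume "h \<in> {NR \<sigma> g L\<^sub>0 | f g. (f, g) \<in> E \<and> NR \<sigma> f L\<^sub>0 = 0 \<and> NR \<sigma> g L\<^sub>0 \<noteq> 0}"
        then show ?thesis using imp by fastforce
      next
        assume "h \<in> {NR \<sigma> f L\<^sub>0 + 1 | f g. (f, g) \<in> E \<and> NR \<sigma> g L\<^sub>0 = 1 \<and> NR \<sigma> f L\<^sub>0 \<noteq> 1}"
        then obtain f g where h: "h = NR \<sigma> f L\<^sub>0 + 1" "(f, g) \<in> E" "NR \<sigma> g L\<^sub>0 = 1" by blast
        \<comment> \<open>If \<open>NR \<sigma> f L\<^sub>0\<close> vanished at \<open>a\<close>,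
          the edge would force the constant 1 to vanish.\<close>
        then have "beval a (NR \<sigma> f L\<^sub>0) = 1"
          using imp [OF h(2)] by (cases "beval a (NR \<sigma> f L\<^sub>0)") auto
        then show ?thesis using h(1) by (simp add: beval_add)
      qed (use True in simp)
      moreover have "\<forall>(p, q)\<in>E'. beval a p = 0 \<longrightarrow> beval a q = 0"
        unfolding pass_components(2) using imp by blast
      ultimately show "a \<in> solutions L' E'" by (auto simp: solutions_def)
    qed
  qed
  then have "solutions L' E' = solutions L\<^sub>0 E" by blast
  also have "\<dots> = solutions L E"
    using red by (intro solutions_span_cong) (simp add: LT_interreduction_def)
  finally show ?thesis .
qed

text \<open>All remainders are 0 in this case, so no edge triggers any of the three actions.
  Elsewhere \<open>1 \<notin> L\<^sub>0\<close> can therefore be assumed.\<close>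

lemma pass_empty: "1 \<in> L\<^sub>0 \<Longrightarrow> L' = L\<^sub>0 \<and> E' = {}"
  unfolding pass_components(1,2) using NR_one_mem [OF ord interreduced_linear] by auto

text \<open>Remainders commute with adding 1, and the conditions for keeping an edge are invariant
  under complementing and swapping its ends.\<close>

lemma pass_contrapositive:
  assumes "(p, q) \<in> E'"
  shows "(q + 1, p + 1) \<in> E'"
proof -
  have one: "1 \<notin> L\<^sub>0" using pass_empty assms by auto
  obtain f g where fg: "(f, g) \<in> E" "p = NR \<sigma> f L\<^sub>0" "q = NR \<sigma> g L\<^sub>0"
    "p \<notin> {0, 1}" "q \<notin> {0, 1}" "p \<noteq> q"
    using assms unfolding pass_components(2) by blast
  have "NR \<sigma> (f + 1) L\<^sub>0 = p + 1" "NR \<sigma> (g + 1) L\<^sub>0 = q + 1"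
    using NR_add_one [OF ord interreduced_linear one] edges_linear [OF fg(1)] fg by simp_all
  moreover have "(g + 1, f + 1) \<in> E" using igs fg(1) unfolding is_IGS_iff by blast
  ultimately show ?thesis
    unfolding pass_components(2) using fg(4-6)
    by (intro CollectI exI [of _ "g + 1"] exI [of _ "f + 1"]) simp
qed

lemma pass_IGS: "is_IGS F (L', V', E')"
  unfolding is_IGS_iff
proof (intro conjI)
  show "E' \<subseteq> V' \<times> V'" unfolding pass_components(3) by (auto simp: Field_def)
  show "solutions L' E' = {a. sat a F}"
    using pass_solutions igs unfolding is_IGS_iff by simp
  show "\<forall>p q. (p, q) \<in> E' \<longrightarrow> (q + 1, p + 1) \<in> E'" using pass_contrapositive by blast
  show "\<forall>f. (f, f) \<notin> E'" unfolding pass_components(2) by blast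
qed (fact pass_linear)+

lemma pass_le: "(L', V', E') \<preceq> (L, V, E)"
proof -
  have "F2.span L\<^sub>0 \<subseteq> F2.span L'" by (rule F2.span_mono) (auto simp: pass_components(1))
  moreover have "V' \<subseteq> (\<lambda>f. NR \<sigma> f L\<^sub>0) ` V"
    unfolding pass_components(2,3) Field_def using igs unfolding is_IGS_iff by blast
  then have "card V' \<le> card V" by (meson card_image_le card_mono finite order_trans)
  ultimately show ?thesis using red by (simp add: LT_interreduction_def)
qed

text \<open>This concerns \<open>L\<^sub>0\<close> and not \<open>L'\<close>, whose new elements may
  share terms with vertices. In the returning pass both sets coincide, which gives
  reducedness.\<close>

lemma pass_disjoint: "LT \<sigma> ` L\<^sub>0 \<inter> (\<Union>f\<in>V'. Supp f) = {}"
proof (cases "1 \<in> L\<^sub>0")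
  case True
  then show ?thesis using pass_empty by (simp add: pass_components(3))
next
  case False
  have "Supp v \<inter> LT \<sigma> ` L\<^sub>0 = {}" if "v \<in> V'" for v
  proof -
    obtain p q where pq: "(p, q) \<in> E'" "v = p \<or> v = q"
      using \<open>v \<in> V'\<close> unfolding pass_components(3) Field_def by blast
    then obtain f g where "(f, g) \<in> E" "p = NR \<sigma> f L\<^sub>0" "q = NR \<sigma> g L\<^sub>0"
      unfolding pass_components(2) by blast
    with pq(2) edges_linear obtain f where "f \<in> linear_bpolys" "v = NR \<sigma> f L\<^sub>0" by blast
    then show ?thesis using NR_props(2) [OF ord interreduced_linear False] by simp
  qed
  then show ?thesis by blast
qed

lemma pass_span_psubset:
  assumes "L\<^sub>0 \<noteq> L'"
  shows "F2.span L \<subset> F2.span L'"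
proof -
  have one: "1 \<notin> L\<^sub>0" using pass_empty assms by auto
  \<comment> \<open>The variant with \<open>+ 1\<close> avoids the leading terms too, because
    \<open>0\<close> is not among them.\<close>
  have disj: "Supp (NR \<sigma> f L\<^sub>0) \<inter> LT \<sigma> ` L\<^sub>0 = {}" "Supp (NR \<sigma> f L\<^sub>0 + 1) \<inter> LT \<sigma> ` L\<^sub>0 = {}"
    if "f \<in> linear_bpolys" for f
    using NR_props(2) [OF ord interreduced_linear one that] zero_notin_LTs [OF ord interreduced_linear one]
    by (auto simp: Supp_def canonical_add keys_mpoly_add keys_one)
  obtain h where h: "h \<in> L'" "h \<notin> L\<^sub>0"
    using assms pass_components(1) by blast
  then obtain f where "f \<in> linear_bpolys"
      "h = NR \<sigma> f L\<^sub>0 \<and> NR \<sigma> f L\<^sub>0 \<noteq> 0 \<or> h = NR \<sigma> f L\<^sub>0 + 1 \<and> NR \<sigma> f L\<^sub>0 \<noteq> 1"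
    unfolding pass_components(1) using edges_linear by blast
  then have "h \<noteq> 0 \<and> Supp h \<inter> LT \<sigma> ` L\<^sub>0 = {}"
    using disj [of f] by (elim disjE) simp_all
  then have "h \<notin> F2.span L\<^sub>0"
    using span_disjoint_Supp [OF ord interreduced_linear(1)] by blast
  then have "F2.span L\<^sub>0 \<subset> F2.span L'"
    using h by (intro not_in_span_psubset) (auto simp: pass_components(1))
  then show ?thesis using red by (simp add: LT_interreduction_def)
qed

end


section \<open>Strongly connected components\<close>

definition component :: "'v set \<Rightarrow> 'v rel \<Rightarrow> 'v \<Rightarrow> 'v set" where
  "component V E x = {y \<in> V. (x, y) \<in> E\<^sup>* \<and> (y, x) \<in> E\<^sup>*}"

lemma strongly_connected_in_component: "strongly_connected_in V E (component V E x)"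
  unfolding strongly_connected_in_def component_def by (auto intro: rtrancl_trans)

lemma strongly_connected_in_subset_component:
  "strongly_connected_in V E S \<Longrightarrow> x \<in> S \<Longrightarrow> S \<subseteq> component V E x"
  unfolding strongly_connected_in_def component_def by blast

text \<open>A strongly connected set containing \<open>x\<close> lies in the mutual reachability
  class of \<open>x\<close>, and this class is itself strongly connected; so the maximal ones are
  these classes.\<close>

lemma SCCs_eq: "SCCs V E = component V E ` V"
proof (rule set_eqI)
  fix S
  show "S \<in> SCCs V E \<longleftrightarrow> S \<in> component V E ` V"
  proof
    assume S: "S \<in> SCCs V E"
    then obtain x where x: "x \<in> S" by (auto simp: SCCs_def)
    have "strongly_connected_in V E S" using S by (simp add: SCCs_def)
    then have sub: "S \<subseteq> component V E x" and "x \<in> V"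
      using x strongly_connected_in_subset_component [of V E S x]
      by (simp, auto simp: strongly_connected_in_def)
    moreover have "component V E x = S"
      using S sub strongly_connected_in_component [of V E x] by (simp add: SCCs_def)
    ultimately show "S \<in> component V E ` V" by blast
  next
    assume "S \<in> component V E ` V"
    then obtain x where x: "x \<in> V" "S = component V E x" by blast
    then have "x \<in> S" by (simp add: component_def)
    moreover have "T = S" if "strongly_connected_in V E T" "S \<subseteq> T" for T
      using strongly_connected_in_subset_component [OF that(1), of x] that(2) x \<open>x \<in> S\<close> by blast
    ultimately show "S \<in> SCCs V E"
      using x strongly_connected_in_component by (auto simp: SCCs_def)
  qed
qed

lemma SCC_connected: "S \<in> SCCs V E \<Longrightarrow> x \<in> S \<Longrightarrow> y \<in> S \<Longrightarrow> (x, y) \<in> E\<^sup>*"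
  by (auto simp: SCCs_def strongly_connected_in_def)

lemma SCC_subset: "S \<in> SCCs V E \<Longrightarrow> S \<subseteq> V"
  by (auto simp: SCCs_def strongly_connected_in_def)

lemma acyclic_if_SCC_polys_empty:
  assumes empty: "SCC_polys c (SCCs V E) = {}"
    and E: "E \<subseteq> V \<times> V" "\<forall>f. (f, f) \<notin> E"
  shows "acyclic E"
proof (rule acyclicI, rule allI, rule notI)
  fix x assume "(x, x) \<in> E\<^sup>+"
  \<comment> \<open>The successor \<open>y\<close> of \<open>x\<close> on the cycle differs from
    \<open>x\<close>, as there are no loops, and leads back to \<open>x\<close>; the component of
    \<open>x\<close> then has two elements and contributes a polynomial.\<close>
  then obtain y where y: "(x, y) \<in> E" "(y, x) \<in> E\<^sup>*" by (meson tranclD)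
  then have xy: "x \<in> V" "x \<in> component V E x" "y \<in> component V E x" "x \<noteq> y"
    using E by (auto simp: component_def)
  then have "component V E x \<in> SCCs V E" by (simp add: SCCs_eq)
  with empty have "component V E x - {c (component V E x)} = {}"
    unfolding SCC_polys_def by blast
  with xy show False by blast
qed

text \<open>In characteristic 2 the summands paired by \<open>h\<close> cancel in the sum of 1 over
  \<open>X\<close>, and this sum is the cardinality modulo 2.\<close>

lemma even_card_fixpoint_free_involution:
  assumes "\<And>x. x \<in> X \<Longrightarrow> h x \<in> X" "\<And>x. x \<in> X \<Longrightarrow> h (h x) = x" "\<And>x. x \<in> X \<Longrightarrow> h x \<noteq> x"
  shows "even (card X)"
proof -
  have "(\<Sum>x\<in>X. 1 :: bit) = 0"
    using assms by (intro sum_involution_eq_0 [of X _ h]) (simp_all add: one_add_one)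
  then have "(of_nat (card X) :: bit) = 0" by simp
  then show ?thesis by (metis even_of_nat dvd_0_right)
qed

lemma odd_SCCs_unsat:
  fixes L :: "'n::finite bpoly set"
  assumes sym: "\<forall>p q. (p, q) \<in> E \<longrightarrow> (q + 1, p + 1) \<in> E" and V: "V = Field E"
    and odd: "odd (card (SCCs V E))"
  shows "solutions L E = {}"
proof (rule ccontr)
  assume "solutions L E \<noteq> {}"
  then obtain a where a: "a \<in> solutions L E" by blast
  let ?h = "\<lambda>S. (\<lambda>f. f + 1) ` S"
  \<comment> \<open>Contraposition of each edge reverses paths, so complementing maps components to
    components.\<close>
  have path: "(q + 1, p + 1) \<in> E\<^sup>*" if "(p, q) \<in> E\<^sup>*" for p q
    using that by induction (use sym in \<open>auto intro: converse_rtrancl_into_rtrancl\<close>)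
  \<comment> \<open>Every vertex is an end of an edge, whose contrapositive has the complement as an
    end.\<close>
  have in_V: "p + 1 \<in> V" if "p \<in> V" for p
    using that sym unfolding V Field_def by blast
  have sub: "?h (component V E x) \<subseteq> component V E (x + 1)" for x
    using path in_V unfolding component_def by blast
  have inv: "?h (?h S) = S" for S :: "'n bpoly set"
    by (simp add: image_image)
  have comp: "?h (component V E x) = component V E (x + 1)" for x
  proof
    have "?h (?h (component V E (x + 1))) \<subseteq> ?h (component V E x)"
      using sub [of "x + 1"] by (intro image_mono) simp
    then show "component V E (x + 1) \<subseteq> ?h (component V E x)" by (simp only: inv)
  qed (fact sub)
  have "even (card (SCCs V E))"
  proof (rule even_card_fixpoint_free_involution [where h = ?h])
    fix S assume "S \<in> SCCs V E"
    then obtain x where x: "x \<in> V" "S = component V E x" by (auto simp: SCCs_eq)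
    show "?h S \<in> SCCs V E" using x in_V comp by (simp add: SCCs_eq)
    show "?h (?h S) = S" by (rule inv)
    show "?h S \<noteq> S"
    proof
      assume "?h S = S"
      then have "component V E (x + 1) = component V E x" using x comp by simp
      moreover have "x + 1 \<in> component V E (x + 1)" using in_V x by (simp add: component_def)
      ultimately have "(x, x + 1) \<in> E\<^sup>*" "(x + 1, x) \<in> E\<^sup>*" by (auto simp: component_def)
      \<comment> \<open>One of \<open>x\<close> and \<open>x + 1\<close> is 0 at the solution
        \<open>a\<close>; the paths then make the other 0 as well.\<close>
      from this [THEN solutions_path [OF a]] show False
        by (cases "beval a x") (simp_all add: beval_add)
    qed
  qed
  with odd show False by simp
qed

text \<open>Elements of one component imply each other, so they agree at every solution and their
  sums vanish there.\<close>

lemma SCC_polys_solutions: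
  assumes c: "\<forall>S\<in>SCCs V E. c S \<in> S"
  shows "solutions (L \<union> SCC_polys c (SCCs V E)) E = solutions L E"
proof -
  have "beval a h = 0" if a: "a \<in> solutions L E" and h: "h \<in> SCC_polys c (SCCs V E)" for a h
  proof -
    obtain S f where S: "S \<in> SCCs V E" "f \<in> S" "h = c S + f"
      using h by (auto simp: SCC_polys_def)
    have "c S \<in> S" using c S(1) by simp
    then have "(c S, f) \<in> E\<^sup>*" "(f, c S) \<in> E\<^sup>*" using SCC_connected [OF S(1)] S(2) by simp_all
    from this [THEN solutions_path [OF a]] show ?thesis
      unfolding S by (cases "beval a f"; cases "beval a (c S)") (simp_all add: beval_add)
  qed
  moreover have "solutions (L \<union> H) E = {a \<in> solutions L E. \<forall>h\<in>H. beval a h = 0}" for H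
    by (auto simp: solutions_def)
  ultimately show ?thesis by blast
qed


section \<open>Termination and correctness of crGGCP\<close>

text \<open>For linear \<open>L\<close>, the number of linear polynomials outside the span, used in
  place of the codimension; natural subtraction is exact in that case.\<close>

definition codim :: "'n::finite bpoly set \<Rightarrow> nat" where
  "codim L = card (linear_bpolys :: 'n bpoly set) - card (F2.span L)"

lemma codim_less:
  assumes "F2.span L \<subset> F2.span L'" "L' \<subseteq> linear_bpolys"
  shows "codim L' < codim L"
proof -
  have "card (F2.span L) < card (F2.span L')" using assms(1) by (intro psubset_card_mono) simp_all
  moreover have "card (F2.span L') \<le> card (linear_bpolys :: 'a bpoly set)"
    using span_linear_bpolys [OF assms(2)] by (intro card_mono) simp_all
  ultimately show ?thesis by (simp add: codim_def)
qed

text \<open>The offsets 2, 1, 0 order the phases while the span stays the same. The factor 3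
  outweighs the rise from 1 to 2 when GGCP is restarted with a larger span.\<close>

fun crGGCP_measure :: "'n::finite crGGCP_state \<Rightarrow> nat" where
  "crGGCP_measure (In_GGCP (GGCP_Run (L, V, E))) = 2 + 3 * codim L"
| "crGGCP_measure (In_GGCP (GGCP_Return (L, V, E))) = 1 + 3 * codim L"
| "crGGCP_measure (crGGCP_Return G) = 0"

text \<open>The clause \<open>V = Field E\<close> is recorded when GGCP returns because the parity
  argument needs complements of vertices; an input graph may have isolated vertices.\<close>

fun crGGCP_inv :: "'n trm rel \<Rightarrow> 'n::finite xnf \<Rightarrow> 'n igs \<Rightarrow> 'n crGGCP_state \<Rightarrow> bool" where
  "crGGCP_inv \<sigma> F G (In_GGCP (GGCP_Run G')) \<longleftrightarrow> is_IGS F G' \<and> G' \<preceq> G"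
| "crGGCP_inv \<sigma> F G (In_GGCP (GGCP_Return (L, V, E))) \<longleftrightarrow>
     is_IGS F (L, V, E) \<and> reduced_IGS \<sigma> (L, V, E) \<and> (L, V, E) \<preceq> G \<and> V = Field E"
| "crGGCP_inv \<sigma> F G (crGGCP_Return (L, V, E)) \<longleftrightarrow>
     is_IGS F (L, V, E) \<and> reduced_IGS \<sigma> (L, V, E) \<and> (L, V, E) \<preceq> G \<and> acyclic E"

declare is_IGS.simps [simp del] reduced_IGS.simps [simp del] igs_le.simps [simp del]
  GGCP_pass.simps [simp del]

lemma crGGCP_step_decreases:
  fixes \<sigma> :: "'n::finite trm rel"
  assumes ord: "term_ordering \<sigma>" and GL: "is_IGS F G"
    and step: "crGGCP_step \<sigma> s t" and inv: "crGGCP_inv \<sigma> F G s"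
  shows "crGGCP_inv \<sigma> F G t \<and> crGGCP_measure t < crGGCP_measure s"
  using step
proof cases
  case (GGCP s' t')
  from GGCP(3) show ?thesis
  proof cases
    case (repeat L L\<^sub>0 E L' V' E' V)
    have igs: "is_IGS F (L, V, E)" and le: "(L, V, E) \<preceq> G" using inv GGCP repeat by simp_all
    note p = ord igs repeat(3,4)
    have "codim L' < codim L"
      using pass_span_psubset [OF p repeat(5)] pass_linear(1) [OF p] by (rule codim_less)
    then show ?thesis
      using pass_IGS [OF p] igs_le_trans [OF pass_le [OF p] le] GGCP repeat by simp
  next
    case (return L L\<^sub>0 E L' V' E' V)
    have igs: "is_IGS F (L, V, E)" and le: "(L, V, E) \<preceq> G" using inv GGCP return by simp_all
    note p = ord igs return(3,4)
    \<comment> \<open>In the returning pass the span is unchanged and only the phase offset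
      decreases.\<close>
    have "codim L' = codim L"
      using return(3,5) by (simp add: codim_def LT_interreduction_def)
    moreover have "reduced_IGS \<sigma> (L', V', E')"
      using interreduced_linear(1) [OF p] pass_disjoint [OF p] return(5)
      by (simp add: reduced_IGS.simps)
    ultimately show ?thesis
      using pass_IGS [OF p] igs_le_trans [OF pass_le [OF p] le] pass_components(3) [OF p] GGCP return
      by simp
  qed
next
  case (odd V' E' B L')
  have igs: "is_IGS F (L', V', E')" and V: "V' = Field E'"
    using inv unfolding odd(1) crGGCP_inv.simps by blast+
  have "F2.span B = linear_bpolys"
    using odd(4) F2.span_span unfolding LT_interreduction_def linear_bpolys_def by blast
  then have B: "B \<subseteq> linear_bpolys" "1 \<in> F2.span B"
    using F2.span_superset one_in_linear_bpolys by blast+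
  have "\<not> (\<forall>g\<in>B. beval a g = 0)" for a
    using vanish_on_span [OF _ B(2), of a] by (metis beval_1 zero_neq_one)
  \<comment> \<open>Neither side has a solution: the span of \<open>B\<close> contains 1, and an odd
    number of components makes the formula unsatisfiable.\<close>
  then have "solutions B {} = {}" unfolding solutions_def by blast
  moreover have "{a. sat a F} = {}"
    using odd_SCCs_unsat [OF _ V odd(3), of L'] igs unfolding is_IGS_iff by simp
  ultimately have "is_IGS F (B, {}, {})" using B by (simp add: is_IGS_iff)
  moreover have "reduced_IGS \<sigma> (B, {}, {})"
    using odd(4) by (simp add: reduced_IGS.simps LT_interreduction_def)
  moreover obtain L V E where G: "G = (L, V, E)" by (cases G)
  have "(B, {}, {}) \<preceq> G"
    using GL span_linear_bpolys [of L] \<open>F2.span B = linear_bpolys\<close>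
    by (simp add: G igs_le.simps is_IGS_iff)
  ultimately show ?thesis using odd by (simp add: acyclic_def)
next
  case (repeat V' E' c L')
  have igs: "is_IGS F (L', V', E')" and red: "reduced_IGS \<sigma> (L', V', E')"
    and le: "(L', V', E') \<preceq> G"
    using inv unfolding repeat(1) crGGCP_inv.simps by blast+
  let ?P = "SCC_polys c (SCCs V' E')"
  have P: "\<exists>f g. f \<in> V' \<and> g \<in> V' \<and> f \<noteq> g \<and> h = f + g" if "h \<in> ?P" for h
    using that repeat(4) SCC_subset [of _ V' E'] unfolding SCC_polys_def by blast
  have lin: "L' \<union> ?P \<subseteq> linear_bpolys"
  proof (intro Un_least subsetI)
    fix h assume "h \<in> ?P"
    then obtain f g where "f \<in> V'" "g \<in> V'" "h = f + g" using P by blast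
    then show "h \<in> linear_bpolys"
      using igs linear_bpolys_add [of f g] unfolding is_IGS_iff by blast
  qed (use igs in \<open>auto simp: is_IGS_iff\<close>)
  have "is_IGS F (L' \<union> ?P, V', E')"
    using igs lin SCC_polys_solutions [OF repeat(4), of L'] unfolding is_IGS_iff by simp
  moreover have "(L' \<union> ?P, V', E') \<preceq> (L', V', E')"
    by (simp add: igs_le.simps F2.span_mono)
  moreover have "codim (L' \<union> ?P) < codim L'"
  proof (rule codim_less [OF _ lin])
    obtain h where h: "h \<in> ?P" using repeat(5) by blast
    with P obtain f g where fg: "f \<in> V'" "g \<in> V'" "f \<noteq> g" "h = f + g" by blast
    \<comment> \<open>Reducedness keeps the supports of vertices, hence that of their sum
      \<open>h\<close>, clear of the leading terms of \<open>L'\<close>; being nonzero,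
      \<open>h\<close> lies outside the span.\<close>
    have dist: "distinct_LTs \<sigma> L'"
      and "Supp f \<inter> LT \<sigma> ` L' = {}" "Supp g \<inter> LT \<sigma> ` L' = {}"
      using red fg unfolding reduced_IGS.simps by blast+
    moreover have "Supp h \<subseteq> Supp f \<union> Supp g"
      by (auto simp: Supp_def fg canonical_add keys_mpoly_add)
    ultimately have "Supp h \<inter> LT \<sigma> ` L' = {}" by blast
    moreover have "h \<noteq> 0" using fg by simp
    ultimately have "h \<notin> F2.span L'" using span_disjoint_Supp [OF ord dist, of h] by blast
    then show "F2.span L' \<subset> F2.span (L' \<union> ?P)"
      using h by (intro not_in_span_psubset) auto
  qed
  ultimately show ?thesis using igs_le_trans le repeat by (auto intro: igs_le_trans)
next
  case (return V' E' c L')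
  have "acyclic E'"
    using inv return(5) unfolding return(1) crGGCP_inv.simps is_IGS_iff
    by (intro acyclic_if_SCC_polys_empty) blast+
  moreover from inv have "crGGCP_inv \<sigma> F G t" if "acyclic E'"
    using that unfolding return(1,2) crGGCP_inv.simps by blast
  ultimately show ?thesis using return(1,2) by simp
qed

text \<open>The free choices never block: an interreduction always exists, components are nonempty
  and so have a first element, and the three rules after GGCP cover all cases.\<close>

lemma crGGCP_progress:
  assumes ord: "term_ordering \<sigma>" and stuck: "\<nexists>t. crGGCP_step \<sigma> s t"
  shows "\<exists>G'. s = crGGCP_Return G'"
proof (cases s)
  case (In_GGCP g)
  have "\<exists>t. crGGCP_step \<sigma> s t"
  proof (cases g)
    case (GGCP_Run G)
    obtain L V E where G: "G = (L, V, E)" by (cases G)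
    obtain L\<^sub>0 where L0: "LT_interreduction \<sigma> L L\<^sub>0" using LT_interreduction_exists [OF ord] by blast
    obtain L' V' E' where "GGCP_pass \<sigma> L\<^sub>0 E = (L', V', E')" by (metis prod_cases3)
    then have "\<exists>t. GGCP_step \<sigma> g t"
      unfolding GGCP_Run G using L0 GGCP_step.intros by blast
    then show ?thesis unfolding In_GGCP using crGGCP_step.GGCP by blast
  next
    case (GGCP_Return G)
    obtain L V E where G: "G = (L, V, E)" by (cases G)
    show ?thesis
    proof (cases "odd (card (SCCs V E))")
      case True
      then show ?thesis
        unfolding In_GGCP GGCP_Return G using LT_interreduction_exists [OF ord] crGGCP_step.odd by blast
    next
      case False
      define c :: "'a bpoly set \<Rightarrow> 'a bpoly" where "c S = (SOME x. x \<in> S)" for S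
      have c: "\<forall>S\<in>SCCs V E. c S \<in> S" by (auto simp: c_def SCCs_def some_in_eq)
      show ?thesis
      proof (cases "SCC_polys c (SCCs V E) = {}")
        case True
        show ?thesis unfolding In_GGCP GGCP_Return G
          by (rule exI, rule crGGCP_step.return [OF _ c True]) (use False in simp)
      next
        case nonempty: False
        show ?thesis unfolding In_GGCP GGCP_Return G
          by (rule exI, rule crGGCP_step.repeat [OF _ c nonempty]) (use False in simp)
      qed
    qed
  qed
  with stuck show ?thesis by blast
qed blast

theorem proposition4p13:
  fixes \<sigma> :: "'n::finite trm rel" and F :: "'n xnf" and G :: "'n igs"
  assumes "term_ordering \<sigma>" and "two_xnf F" and "is_IGS F G"
  shows "crGGCP_terminates \<sigma> G \<and>
    (\<forall>L' V' E'. crGGCP_output \<sigma> G (L', V', E') \<longrightarrow>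
       (is_IGS F (L', V', E') \<and> reduced_IGS \<sigma> (L', V', E')) \<and>
       (L', V', E') \<preceq> G \<and>
       acyclic E')"
proof -
  note dec = crGGCP_step_decreases [OF assms(1,3)]
  have start: "crGGCP_inv \<sigma> F G (crGGCP_start G)"
    using assms(3) by (cases G) (simp add: crGGCP_start_def igs_le.simps)
  have "False" if r: "r 0 = crGGCP_start G" "\<forall>k::nat. crGGCP_step \<sigma> (r k) (r (Suc k))" for r
  proof -
    have inv: "crGGCP_inv \<sigma> F G (r k)" for k
      by (induction k) (use start r dec in auto)
    \<comment> \<open>Each step costs at least one unit, so the initial measure bounds the length of
      a run.\<close>
    have "crGGCP_measure (r k) + k \<le> crGGCP_measure (r 0)" for k
    proof (induction k)
      case (Suc k)
      have "crGGCP_measure (r (Suc k)) < crGGCP_measure (r k)" using dec inv r(2) by blast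
      with Suc show ?case by linarith
    qed simp
    from this [of "Suc (crGGCP_measure (r 0))"] show False by simp
  qed
  then have "crGGCP_terminates \<sigma> G"
    unfolding crGGCP_terminates_def using crGGCP_progress [OF assms(1)] by blast
  \<comment> \<open>The invariant holds along every finite run; in a returned state it is the
    conjunction of the claimed properties.\<close>
  moreover have "crGGCP_inv \<sigma> F G s" if "(crGGCP_step \<sigma>)\<^sup>*\<^sup>* (crGGCP_start G) s" for s
    using that by induction (use start dec in auto)
  then have "crGGCP_inv \<sigma> F G (crGGCP_Return (L', V', E'))"
    if "crGGCP_output \<sigma> G (L', V', E')" for L' V' E'
    using that by (simp only: crGGCP_output_def)
  ultimately show ?thesis by (simp only: crGGCP_inv.simps) blast
qed

end
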